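(* Let $\mathbf{t}$ be the Thue--Morse word and let $L_{\mathbf{t}}$ denote the set of all finite words over the alphabet $\{0,1\}$ that are not subwords of $\mathbf{t}$. Then $L_{\mathbf{t}}$ is not unambiguously context-free.
   Context: The Thue--Morse word is the infinite word $\mathbf{t} = \mu^\omega(0) = 0110100110010110\cdots$, the infinite fixed point starting with $0$ of the morphism $\mu$ on $\{0,1\}^*$ with $\mu(0)=01$, $\mu(1)=10$; equivalently $\mathbf{t} = t(0)t(1)t(2)\cdots$ with $t(n) = s_2(n) \bmod 2$, where $s_2(n)$ is the sum of the digits in the base-$2$ expansion of $n$. "Subword" means contiguous block (factor): a finite word $u$ is a subword of an infinite word $\mathbf{w}$ if $\mathbf{w} = pu\mathbf{q}$ for some finite (possibly empty) word $p$ and infinite word $\mathbf{q}$. A language is unambiguously context-free if it is generated by some unambiguous context-free grammar, i.e. a context-free grammar in which every generated word has exactly one derivation tree (equivalently, exactly one leftmost derivation). *)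

theory Defs
  imports "HOL-Library.Stream"
begin

section \<open>Context-free grammars\<close>

datatype ('n, 'a) symbol = Nt 'n | Tm 'a

text \<open>The nonterminals and terminals of a grammar are the symbols that occur in it; both sets are
  finite as soon as the set of productions is.\<close>

record ('n, 'a) cfg =
  productions :: "('n \<times> ('n, 'a) symbol list) set"
  start :: 'n

definition wf_cfg :: "('n, 'a) cfg \<Rightarrow> bool" where
  "wf_cfg G \<longleftrightarrow> finite (productions G)"

definition derives1 :: "('n, 'a) cfg \<Rightarrow> ('n, 'a) symbol list \<Rightarrow> ('n, 'a) symbol list \<Rightarrow> bool" where
  "derives1 G u v \<longleftrightarrow>
     (\<exists>x A \<alpha> y. (A, \<alpha>) \<in> productions G \<and> u = x @ [Nt A] @ y \<and> v = x @ \<alpha> @ y)"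

definition language :: "('n, 'a) cfg \<Rightarrow> 'a list set" where
  "language G = {w. (derives1 G)\<^sup>*\<^sup>* [Nt (start G)] (map Tm w)}"

text \<open>A node without children stands for the application of an empty production.\<close>

datatype ('n, 'a) parse_tree = Leaf 'a | Node 'n "('n, 'a) parse_tree list"

fun root_symbol :: "('n, 'a) parse_tree \<Rightarrow> ('n, 'a) symbol" where
  "root_symbol (Leaf a) = Tm a"
| "root_symbol (Node A ts) = Nt A"

fun frontier :: "('n, 'a) parse_tree \<Rightarrow> 'a list" where
  "frontier (Leaf a) = [a]"
| "frontier (Node A ts) = concat (map frontier ts)"

fun conforms :: "('n, 'a) cfg \<Rightarrow> ('n, 'a) parse_tree \<Rightarrow> bool" where
  "conforms G (Leaf a) = True"
| "conforms G (Node A ts) \<longleftrightarrow>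
     (A, map root_symbol ts) \<in> productions G \<and> (\<forall>t \<in> set ts. conforms G t)"

definition derivation_tree :: "('n, 'a) cfg \<Rightarrow> ('n, 'a) parse_tree \<Rightarrow> 'a list \<Rightarrow> bool" where
  "derivation_tree G t w \<longleftrightarrow> conforms G t \<and> root_symbol t = Nt (start G) \<and> frontier t = w"

definition unambiguous :: "('n, 'a) cfg \<Rightarrow> bool" where
  "unambiguous G \<longleftrightarrow> (\<forall>w \<in> language G. \<exists>!t. derivation_tree G t w)"

text \<open>A definition cannot quantify over the type of nonterminals. Since a grammar has only finitely
  many of them, natural numbers suffice; see \<open>unambiguously_context_freeI\<close> below.\<close>

definition unambiguously_context_free :: "'a list set \<Rightarrow> bool" where
  "unambiguously_context_free L \<longleftrightarrow>
     (\<exists>G :: (nat, 'a) cfg. wf_cfg G \<and> unambiguous G \<and> language G = L)"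


section \<open>The Thue--Morse word\<close>

text \<open>Finite words are lists and infinite words are streams over the letters 0 and 1.\<close>

definition subword :: "'a list \<Rightarrow> 'a stream \<Rightarrow> bool" where
  "subword u w \<longleftrightarrow> (\<exists>p q. w = p @- u @- q)"

fun digit_sum2 :: "nat \<Rightarrow> nat" where
  "digit_sum2 n = (if n = 0 then 0 else n mod 2 + digit_sum2 (n div 2))"

declare digit_sum2.simps [simp del]

definition thue_morse :: "nat stream" where
  "thue_morse = smap (\<lambda>n. digit_sum2 n mod 2) nats"

definition tm_morphism :: "nat list \<Rightarrow> nat list" where
  "tm_morphism u = concat (map (\<lambda>a. if a = 0 then [0, 1] else [1, 0]) u)"


section \<open>Adequacy of the definitions\<close>

lemma digit_sum2_double: "digit_sum2 (2 * n) = digit_sum2 n"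
  by (cases "n = 0") (simp_all add: digit_sum2.simps[of "2 * n"])

lemma digit_sum2_double_Suc: "digit_sum2 (Suc (2 * n)) = Suc (digit_sum2 n)"
  by (simp add: digit_sum2.simps[of "Suc (2 * n)"])

lemma stake_thue_morse: "stake n thue_morse = map (\<lambda>n. digit_sum2 n mod 2) [0..<n]"
  by (rule nth_equalityI) (simp_all add: thue_morse_def)

lemma tm_morphism_stake: "tm_morphism (stake n thue_morse) = stake (2 * n) thue_morse"
proof (induction n)
  case 0
  then show ?case by (simp add: tm_morphism_def)
next
  case (Suc n)
  have "tm_morphism (stake (Suc n) thue_morse)
      = tm_morphism (stake n thue_morse) @ tm_morphism [digit_sum2 n mod 2]"
    by (simp add: stake_thue_morse tm_morphism_def)
  also have "tm_morphism [digit_sum2 n mod 2] =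
      [digit_sum2 (2 * n) mod 2, digit_sum2 (Suc (2 * n)) mod 2]"
    by (simp add: tm_morphism_def digit_sum2_double digit_sum2_double_Suc mod_Suc)
  finally show ?case
    using Suc by (simp add: stake_thue_morse)
qed

theorem stake_thue_morse_eq_iterate: "stake (2 ^ k) thue_morse = (tm_morphism ^^ k) [0]"
proof (induction k)
  case 0
  then show ?case by (simp add: stake_thue_morse digit_sum2.simps[of 0])
next
  case (Suc k)
  then show ?case by (simp add: tm_morphism_stake[symmetric])
qed

lemma derives1_append: "derives1 G u v \<Longrightarrow> derives1 G (x @ u @ y) (x @ v @ y)"
  unfolding derives1_def by (metis append.assoc)

lemma derives_append:
  "(derives1 G)\<^sup>*\<^sup>* u v \<Longrightarrow> (derives1 G)\<^sup>*\<^sup>* (x @ u @ y) (x @ v @ y)"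
  by (induction rule: rtranclp_induct) (auto intro: rtranclp.rtrancl_into_rtrancl derives1_append)

lemma derives_append2:
  assumes "(derives1 G)\<^sup>*\<^sup>* u u'" and "(derives1 G)\<^sup>*\<^sup>* v v'"
  shows "(derives1 G)\<^sup>*\<^sup>* (u @ v) (u' @ v')"
  using derives_append[OF assms(1), of "[]" v] derives_append[OF assms(2), of u' "[]"] by simp

lemma conforms_derives:
  "conforms G t \<Longrightarrow> (derives1 G)\<^sup>*\<^sup>* [root_symbol t] (map Tm (frontier t))"
proof (induction t)
  case (Leaf a)
  then show ?case by simp
next
  case (Node A ts)
  have "(derives1 G)\<^sup>*\<^sup>* (map root_symbol us) (map Tm (concat (map frontier us)))"
    if "set us \<subseteq> set ts" for us
    using that
  proof (induction us)
    case (Cons u us)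
    then show ?case
      using derives_append2[of G "[root_symbol u]" "map Tm (frontier u)" "map root_symbol us"] Node by auto
  qed simp
  moreover have "derives1 G [Nt A] (map root_symbol ts)"
    using Node.prems unfolding derives1_def by fastforce
  ultimately show ?case
    by (auto intro: converse_rtranclp_into_rtranclp)
qed

lemma derives_forest:
  assumes "(derives1 G)\<^sup>*\<^sup>* u (map Tm w)"
  shows "\<exists>ts. map root_symbol ts = u \<and> (\<forall>t \<in> set ts. conforms G t) \<and> concat (map frontier ts) = w"
  using assms
proof (induction rule: converse_rtranclp_induct)
  case base
  show ?case
    by (rule exI[of _ "map Leaf w"]) (induction w, auto)
next
  case (step u v)
  then obtain x A \<alpha> y ts where P: "(A, \<alpha>) \<in> productions G" and u: "u = x @ [Nt A] @ y"
    and v: "map root_symbol ts = x @ \<alpha> @ y" and ts: "\<forall>t \<in> set ts. conforms G t"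
    "concat (map frontier ts) = w"
    unfolding derives1_def by blast
  from v obtain a b c where "ts = a @ b @ c" "map root_symbol a = x" "map root_symbol b = \<alpha>" "map root_symbol c = y"
    by (metis (no_types, opaque_lifting) map_eq_append_conv)
  with P u ts show ?case
    by (intro exI[of _ "a @ [Node A b] @ c"]) auto
qed

theorem language_eq_trees: "language G = {w. \<exists>t. derivation_tree G t w}"
proof (intro set_eqI iffI)
  fix w assume "w \<in> language G"
  then obtain ts where "map root_symbol ts = [Nt (start G)]" "\<forall>t \<in> set ts. conforms G t"
    "concat (map frontier ts) = w"
    unfolding language_def mem_Collect_eq by (metis derives_forest)
  then show "w \<in> {w. \<exists>t. derivation_tree G t w}"
    by (auto simp: derivation_tree_def map_eq_Cons_conv)
next
  fix w assume "w \<in> {w. \<exists>t. derivation_tree G t w}"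
  then show "w \<in> language G"
    unfolding language_def derivation_tree_def using conforms_derives by fastforce
qed

definition nonterminals :: "('n, 'a) cfg \<Rightarrow> 'n set" where
  "nonterminals G = insert (start G)
     (\<Union>(A, \<alpha>) \<in> productions G. insert A {B. Nt B \<in> set \<alpha>})"

lemma finite_nonterminals:
  fixes G :: "('n, 'a) cfg"
  shows "wf_cfg G \<Longrightarrow> finite (nonterminals G)"
proof -
  have "finite {B. Nt B \<in> set \<alpha>}" for \<alpha> :: "('n, 'a) symbol list"
    by (rule finite_subset[of _ "(\<lambda>s. case s of Nt B \<Rightarrow> B) ` set \<alpha>"]) (force, simp)
  then show "wf_cfg G \<Longrightarrow> finite (nonterminals G)"
    by (auto simp: nonterminals_def wf_cfg_def)
qed

lemma productions_nonterminals:
  "(A, \<alpha>) \<in> productions G \<Longrightarrow> s \<in> set \<alpha> \<Longrightarrow> s \<in> Nt ` nonterminals G \<union> range Tm"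
  by (cases s) (force simp: nonterminals_def)+

definition rename :: "('n \<Rightarrow> 'm) \<Rightarrow> ('n, 'a) cfg \<Rightarrow> ('m, 'a) cfg" where
  "rename f G = \<lparr>productions = map_prod f (map (map_symbol f (\<lambda>x. x))) ` productions G,
                 start = f (start G)\<rparr>"

lemma root_symbol_map_tree: "root_symbol (map_parse_tree f (\<lambda>x. x) t) = map_symbol f (\<lambda>x. x) (root_symbol t)"
  by (cases t) auto

lemma frontier_map_tree: "frontier (map_parse_tree f (\<lambda>x. x) t) = frontier t"
  by (induction t) (auto intro: arg_cong[of _ _ concat])

lemma conforms_map_tree: "conforms G t \<Longrightarrow> conforms (rename f G) (map_parse_tree f (\<lambda>x. x) t)"
proof (induction t)
  case (Node A ts)
  then have "map_prod f (map (map_symbol f (\<lambda>x. x))) (A, map root_symbol ts) \<in> productions (rename f G)"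
    by (auto simp: rename_def simp del: map_prod_simp intro!: imageI)
  with Node show ?case
    by (auto simp: root_symbol_map_tree comp_def)
qed simp

lemma map_symbol_inv:
  assumes "inj_on f N" and "s \<in> Nt ` N \<union> range Tm"
  shows "map_symbol (inv_into N f) (\<lambda>x. x) (map_symbol f (\<lambda>x. x) s) = s"
  using assms by auto

lemma rename_inv:
  assumes "inj_on f (nonterminals G)"
  shows "rename (inv_into (nonterminals G) f) (rename f G) = G"
proof -
  let ?N = "nonterminals G" and ?g = "inv_into (nonterminals G) f"
  have "map_prod ?g (map (map_symbol ?g (\<lambda>x. x))) (map_prod f (map (map_symbol f (\<lambda>x. x))) p) = p"
    if "p \<in> productions G" for p
  proof -
    obtain A \<alpha> where p: "p = (A, \<alpha>)" by force
    have A: "A \<in> ?N" using that p by (force simp: nonterminals_def)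
    have inv: "map_symbol ?g (\<lambda>x. x) (map_symbol f (\<lambda>x. x) s) = s" if "s \<in> set \<alpha>" for s
      by (rule map_symbol_inv[OF assms productions_nonterminals[OF _ that]])
        (use \<open>p \<in> productions G\<close> p in simp)
    have "map (map_symbol ?g (\<lambda>x. x)) (map (map_symbol f (\<lambda>x. x)) \<alpha>) = \<alpha>"
      unfolding map_map comp_def by (rule map_idI) (rule inv)
    then show ?thesis
      using inv_into_f_f[OF assms A] by (simp only: p map_prod_simp)
  qed
  moreover have "?g (f (start G)) = start G"
    by (intro inv_into_f_f assms) (simp add: nonterminals_def)
  ultimately show ?thesis
    by (simp add: rename_def image_image)
qed

lemma map_tree_inv:
  assumes "inj_on f N" and "conforms G t" and "root_symbol t \<in> Nt ` N \<union> range Tm"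
    and "\<And>A \<alpha> s. (A, \<alpha>) \<in> productions G \<Longrightarrow> s \<in> set \<alpha> \<Longrightarrow> s \<in> Nt ` N \<union> range Tm"
  shows "map_parse_tree (inv_into N f) (\<lambda>x. x) (map_parse_tree f (\<lambda>x. x) t) = t"
  using assms(2,3)
proof (induction t)
  case (Node A ts)
  have "map_parse_tree (inv_into N f) (\<lambda>x. x) (map_parse_tree f (\<lambda>x. x) t) = t" if "t \<in> set ts" for t
    using that Node assms(4)[of A "map root_symbol ts" "root_symbol t"] by auto
  then show ?case
    using Node.prems assms(1) by (auto intro!: map_idI)
qed simp

lemma derivation_tree_rename:
  "derivation_tree G t w \<Longrightarrow> derivation_tree (rename f G) (map_parse_tree f (\<lambda>x. x) t) w"
  unfolding derivation_tree_def
  by (auto simp: conforms_map_tree root_symbol_map_tree frontier_map_tree) (simp add: rename_def)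

theorem unambiguously_context_freeI:
  fixes G :: "('n, 'a) cfg"
  assumes "wf_cfg G" and "unambiguous G"
  shows "unambiguously_context_free (language G)"
proof -
  obtain f :: "'n \<Rightarrow> nat" where f: "inj_on f (nonterminals G)"
    using finite_imp_inj_to_nat_seg[OF finite_nonterminals[OF assms(1)]] by blast
  define H where "H = rename f G"
  define g where "g = inv_into (nonterminals G) f"
  have GH: "rename g H = G"
    using rename_inv[OF f] by (simp add: H_def g_def)
  have lang: "language H = language G"
    unfolding language_eq_trees
    using derivation_tree_rename[of G _ _ f] derivation_tree_rename[of H _ _ g]
    unfolding GH H_def[symmetric] by blast
  have N: "nonterminals H \<subseteq> f ` nonterminals G"
  proof
    fix B assume "B \<in> nonterminals H"
    then consider "B = f (start G)"
      | A \<alpha> where "(A, \<alpha>) \<in> productions G" "B = f A"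
      | A \<alpha> where "(A, \<alpha>) \<in> productions G" "Nt B \<in> map_symbol f (\<lambda>x. x) ` set \<alpha>"
      by (auto simp: nonterminals_def H_def rename_def)
    then show "B \<in> f ` nonterminals G"
    proof cases
      case 1
      then show ?thesis by (simp add: nonterminals_def)
    next
      case 2
      then show ?thesis by (force simp: nonterminals_def)
    next
      case 3
      then obtain s where s: "s \<in> set \<alpha>" "map_symbol f (\<lambda>x. x) s = Nt B" by auto
      from s(2) obtain C where "s = Nt C" "B = f C" by (cases s) auto
      with s 3 show ?thesis by (force simp: nonterminals_def)
    qed
  qed
  have g: "inj_on g (nonterminals H)"
    unfolding g_def using N by (rule inj_on_inv_into)
  have "unambiguous H"
    unfolding unambiguous_def
  proof
    fix w assume w: "w \<in> language H"
    then have "\<exists>!t. derivation_tree G t w"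
      using assms(2) lang by (auto simp: unambiguous_def)
    moreover have "t = t'" if "derivation_tree H t w" "derivation_tree H t' w"
      and "\<exists>!t. derivation_tree G t w" for t t'
    proof -
      have inv: "map_parse_tree (inv_into (nonterminals H) g) (\<lambda>x. x) (map_parse_tree g (\<lambda>x. x) s) = s"
        if "derivation_tree H s w" for s
        by (rule map_tree_inv[OF g, of H])
          (use that productions_nonterminals[of _ _ H] in
            \<open>auto simp: derivation_tree_def nonterminals_def\<close>)
      have "map_parse_tree g (\<lambda>x. x) t = map_parse_tree g (\<lambda>x. x) t'"
        using that derivation_tree_rename[of H _ w g] GH by auto
      then show ?thesis
        using inv that by metis
    qed
    moreover have "\<exists>t. derivation_tree H t w"
      using w language_eq_trees by blast
    ultimately show "\<exists>!t. derivation_tree H t w" by blast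
  qed
  moreover have "wf_cfg H"
    using assms(1) by (simp add: wf_cfg_def H_def rename_def)
  ultimately show ?thesis
    unfolding unambiguously_context_free_def using lang by blast
qed

end

theory Submission
  imports Defs "HOL-Computational_Algebra.Polynomial_FPS" "HOL-Library.Multiset"
begin

text \<open>
  The proof compares two facts about the power series
  \<open>F(x) = \<Sum> l(n) x\<^sup>n\<close>, where \<open>l(n)\<close> is the number of words of length \<open>n\<close> over \<open>{0, 1}\<close> that are not
  subwords of the Thue--Morse word.

  If the language were unambiguously context-free, \<open>F\<close> would be algebraic over \<open>\<rat>(x)\<close>: this is the
  theorem of Chomsky and Schuetzenberger. The generating functions \<open>Y\<^sub>A\<close> of the nonterminals satisfy
  a polynomial system \<open>Y\<^sub>A = P\<^sub>A(x, Y)\<close>, and the point is to eliminate variables. Since other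
  components of the solution set of the system may have positive dimension, the system is deformed
  first: for a number \<open>D\<close> that exceeds the lengths of all right-hand sides, each nonterminal \<open>A\<close> gets
  an additional production \<open>A \<rightarrow> A \<dots> A\<close> with \<open>D\<close> copies of \<open>A\<close>, weighted by an indeterminate \<open>\<sigma>\<close>,
  and an indeterminate \<open>t\<close> counts the inner nodes of a tree. The deformed system
  \<open>U\<^sub>A = t (P\<^sub>A(x, U) + \<sigma> U\<^sub>A\<^sup>D)\<close> lets one rewrite \<open>t \<sigma> U\<^sub>A\<^sup>D\<close> as a combination of monomials of degree
  less than \<open>D\<close>. Hence, up to powers of \<open>t \<sigma>\<close>, all monomials in the \<open>U\<^sub>A\<close> lie in the span of the
  finitely many monomials with all exponents less than \<open>D\<close>; so the powers of a single \<open>U\<^sub>A\<close> are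
  linearly dependent over the polynomials (\<open>algebraic_if_reducible\<close>). A polynomial relation survives
  the specialisations \<open>\<sigma> = 0\<close> and \<open>t = 1\<close>, because one may divide it by powers of \<open>\<sigma>\<close> and of \<open>t - 1\<close>
  beforehand. Putting \<open>t = 1\<close> makes sense only if each word has finitely many trees, and it yields
  the number of words only if it has exactly one; this is where unambiguity enters
  (\<open>chomsky_schuetzenberger\<close>).

  On the other hand, \<open>F\<close> is not algebraic. Let \<open>p(n) = 2\<^sup>n - l(n)\<close> be the subword complexity of the
  Thue--Morse word. A subword of length at least 4 occurs at positions of one parity only, and
  this gives \<open>p(2n) = p(n) + p(n + 1)\<close> and \<open>p(2n + 1) = 2 p(n + 1)\<close> for \<open>n \<ge> 2\<close>. The second
  differences \<open>s(n)\<close> of \<open>p\<close> then satisfy \<open>s(2n) = s(n)\<close> and \<open>s(2n + 1) = 0\<close>, so that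
  \<open>h(x) = \<Sum> s(n) x\<^sup>n\<close> and \<open>h(x\<^sup>2)\<close> differ by a polynomial. Comparing the minimal polynomials of \<open>h(x)\<close>
  and \<open>h(x\<^sup>2)\<close> shows that such a series is rational as soon as it is algebraic
  (\<open>rational_if_algebraic_mahler\<close>). But \<open>h\<close> has arbitrarily long gaps after the
  nonzero coefficients \<open>s(4 \<cdot> 2\<^sup>k)\<close>, which a rational series cannot have.
\<close>

section \<open>Algebraic power series\<close>

definition eval_fps :: "'a::comm_ring_1 poly poly \<Rightarrow> 'a fps \<Rightarrow> 'a fps" where
  "eval_fps Q f = poly (map_poly fps_of_poly Q) f"

definition algebraic_fps :: "'a::comm_ring_1 fps \<Rightarrow> bool" where
  "algebraic_fps f \<longleftrightarrow> (\<exists>Q. Q \<noteq> 0 \<and> eval_fps Q f = 0)"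

lemma eval_fps_0 [simp]: "eval_fps 0 f = 0"
  by (simp add: eval_fps_def)

lemma eval_fps_pCons [simp]: "eval_fps (pCons a Q) f = fps_of_poly a + f * eval_fps Q f"
  by (simp add: eval_fps_def map_poly_pCons)

lemma eval_fps_add: "eval_fps (P + Q) f = eval_fps P f + eval_fps Q f"
  by (induction P Q rule: poly_induct2) (simp_all add: fps_of_poly_add algebra_simps)

lemma eval_fps_smult: "eval_fps (smult c Q) f = fps_of_poly c * eval_fps Q f"
  by (induction Q) (simp_all add: fps_of_poly_mult algebra_simps)

lemma eval_fps_diff: "eval_fps (P - Q) f = eval_fps P f - eval_fps Q f"
  using eval_fps_add[of "P - Q" Q f] by simp

lemma eval_fps_mult: "eval_fps (P * Q) f = eval_fps P f * eval_fps Q f"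
  by (induction P) (simp_all add: eval_fps_add eval_fps_smult algebra_simps)

lemma eval_fps_pcompose: "eval_fps (pcompose P Q) f = eval_fps P (eval_fps Q f)"
  by (induction P) (simp_all add: pcompose_pCons eval_fps_add eval_fps_mult)

lemma eval_fps_altdef: "eval_fps Q f = (\<Sum>i\<le>degree Q. fps_of_poly (coeff Q i) * f ^ i)"
proof -
  have "degree (map_poly fps_of_poly Q) = degree Q"
    by (rule degree_map_poly) (simp add: fps_eq_iff poly_eq_iff)
  then show ?thesis by (simp add: eval_fps_def poly_altdef coeff_map_poly)
qed

text \<open>Here \<open>b f = a + c g\<close>, so a polynomial that vanishes at \<open>b f\<close> becomes one that vanishes at \<open>g\<close>
  after the substitution of \<open>a + c y\<close> for the unknown.\<close>

lemma algebraic_fps_of_affine: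
  fixes f g :: "'a::idom fps"
  assumes f: "algebraic_fps f" and c: "c \<noteq> 0"
    and fg: "fps_of_poly b * f = fps_of_poly a + fps_of_poly c * g"
  shows "algebraic_fps g"
proof -
  obtain Q where Q: "Q \<noteq> 0" "eval_fps Q f = 0"
    using f by (auto simp: algebraic_fps_def)
  \<comment> \<open>\<open>P\<close> is \<open>b\<^sup>n Q(y / b)\<close>, which vanishes at \<open>b f\<close>.\<close>
  define n where "n = degree Q"
  define P where "P = (\<Sum>i\<le>n. monom (coeff Q i * b ^ (n - i)) i)"
  have coeffP: "coeff P i = (if i \<le> n then coeff Q i * b ^ (n - i) else 0)" for i
    unfolding P_def by (simp add: coeff_sum coeff_monom)
  have "coeff P n \<noteq> 0" using Q(1) by (simp add: coeffP n_def)
  then have P0: "P \<noteq> 0" by auto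
  have degP: "degree P \<le> n" by (rule degree_le) (simp add: coeffP)
  have "eval_fps P (fps_of_poly b * f)
      = (\<Sum>i\<le>n. fps_of_poly (coeff P i) * (fps_of_poly b * f) ^ i)"
    unfolding eval_fps_altdef
    by (rule sum.mono_neutral_left) (use degP in \<open>auto simp: coeff_eq_0\<close>)
  also have "\<dots> = (\<Sum>i\<le>n. fps_of_poly b ^ n * (fps_of_poly (coeff Q i) * f ^ i))"
  proof (rule sum.cong[OF refl])
    fix i assume "i \<in> {..n}"
    then have "fps_of_poly b ^ n = fps_of_poly b ^ (n - i) * fps_of_poly b ^ i"
      by (simp flip: power_add)
    with \<open>i \<in> {..n}\<close> show "fps_of_poly (coeff P i) * (fps_of_poly b * f) ^ i
        = fps_of_poly b ^ n * (fps_of_poly (coeff Q i) * f ^ i)"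
      by (simp add: coeffP fps_of_poly_mult fps_of_poly_power power_mult_distrib)
  qed
  also have "\<dots> = fps_of_poly b ^ n * eval_fps Q f"
    by (simp add: eval_fps_altdef n_def sum_distrib_left)
  finally have "eval_fps P (fps_of_poly b * f) = 0" using Q by simp
  moreover have "eval_fps [:a, c:] g = fps_of_poly b * f"
    using fg by (simp add: mult.commute)
  ultimately have "eval_fps (pcompose P [:a, c:]) g = 0"
    by (simp add: eval_fps_pcompose)
  moreover have "pcompose P [:a, c:] \<noteq> 0"
    using P0 c by (simp add: pcompose_eq_0_iff)
  ultimately show ?thesis by (auto simp: algebraic_fps_def)
qed

section \<open>The subword complexity of the Thue--Morse word\<close>

definition tm :: "nat \<Rightarrow> nat" where
  "tm i = digit_sum2 i mod 2"

definition tm_factor :: "nat \<Rightarrow> nat \<Rightarrow> nat list" where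
  "tm_factor m i = map (\<lambda>k. tm (i + k)) [0..<m]"

definition tm_complexity :: "nat \<Rightarrow> nat" where
  "tm_complexity m = card (range (tm_factor m))"

lemma tm_cases: "tm i = 0 \<or> tm i = 1"
  by (auto simp: tm_def)

lemma tm_double: "tm (2 * i) = tm i"
  by (simp add: tm_def digit_sum2_double)

lemma tm_double_Suc: "tm (Suc (2 * i)) = 1 - tm i"
  by (simp add: tm_def digit_sum2_double_Suc mod_Suc)

lemma tm_factor_eq_iff: "tm_factor m i = tm_factor m j \<longleftrightarrow> (\<forall>k<m. tm (i + k) = tm (j + k))"
  by (auto simp: tm_factor_def)

lemma subword_thue_morse_iff: "subword u thue_morse \<longleftrightarrow> u \<in> range (tm_factor (length u))"
proof
  assume "subword u thue_morse"
  then obtain p q where pq: "thue_morse = p @- u @- q" unfolding subword_def by blast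
  have "u ! k = tm (length p + k)" if "k < length u" for k
  proof -
    have "thue_morse !! (length p + k) = u ! k" using that by (simp add: pq)
    then show ?thesis by (simp add: thue_morse_def tm_def)
  qed
  then have "u = tm_factor (length u) (length p)"
    by (intro nth_equalityI) (simp_all add: tm_factor_def)
  then show "u \<in> range (tm_factor (length u))" by blast
next
  assume "u \<in> range (tm_factor (length u))"
  then obtain i where i: "u = tm_factor (length u) i" by blast
  have "stake (length u) (sdrop i thue_morse) = u"
    by (subst (2) i) (intro nth_equalityI, simp_all add: tm_factor_def sdrop_snth thue_morse_def tm_def add.commute)
  then have "thue_morse = stake i thue_morse @- u @- sdrop (length u) (sdrop i thue_morse)"
    by (metis stake_sdrop)
  then show "subword u thue_morse" unfolding subword_def by blast
qed

lemma range_tm_factor_subset: "range (tm_factor m) \<subseteq> {u \<in> lists {0, 1}. length u = m}"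
proof -
  have "tm_factor m i \<in> lists {0, 1}" for i
    unfolding tm_factor_def lists_eq_set using tm_cases by (simp add: image_subset_iff)
  moreover have "length (tm_factor m i) = m" for i
    by (simp add: tm_factor_def)
  ultimately show ?thesis by blast
qed

lemma finite_binary_words: "finite {u \<in> lists {0, 1 :: nat}. length u = m}"
  using finite_lists_length_eq[of "{0, 1 :: nat}" m] by (simp add: lists_eq_set conj_commute)

lemma card_binary_words: "card {u \<in> lists {0, 1 :: nat}. length u = m} = 2 ^ m"
  using card_lists_length_eq[of "{0, 1 :: nat}" m]
  by (simp add: lists_eq_set conj_commute numeral_2_eq_2)

lemma finite_range_tm_factor: "finite (range (tm_factor m))"
  using range_tm_factor_subset finite_binary_words by (rule finite_subset)

lemma card_non_subwords:
  "card {u \<in> {u \<in> lists {0, 1}. \<not> subword u thue_morse}. length u = m} + tm_complexity m = 2 ^ m"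
proof -
  let ?W = "{u \<in> lists {0, 1 :: nat}. length u = m}"
  have "{u \<in> {u \<in> lists {0, 1}. \<not> subword u thue_morse}. length u = m} = ?W - range (tm_factor m)"
    by (auto simp: subword_thue_morse_iff)
  then have "card {u \<in> {u \<in> lists {0, 1}. \<not> subword u thue_morse}. length u = m}
      = card ?W - tm_complexity m"
    using range_tm_factor_subset finite_range_tm_factor by (simp add: card_Diff_subset tm_complexity_def)
  moreover have "tm_complexity m \<le> card ?W"
    unfolding tm_complexity_def by (intro card_mono finite_binary_words range_tm_factor_subset)
  ultimately show ?thesis using card_binary_words[of m] by linarith
qed

text \<open>Among three consecutive letters there are two that form an image \<open>01\<close> or \<open>10\<close> of a letter.\<close>

lemma tm_no_cube: "\<not> (tm i = tm (i + 1) \<and> tm (i + 1) = tm (i + 2))"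
proof -
  have ne: "tm (2 * j) \<noteq> tm (Suc (2 * j))" for j
    using tm_cases[of j] by (auto simp: tm_double tm_double_Suc)
  show ?thesis
  proof (cases "even i")
    case True
    then show ?thesis using ne[of "i div 2"] by auto
  next
    case False
    then show ?thesis using ne[of "(i + 1) div 2"] by auto
  qed
qed

text \<open>If a word of length 4 occurs at positions of both parities, then all of its pairs of neighbours
  are images of letters, so it alternates. The pairs seen from the odd position are then all the
  same, and the three letters they come from form a cube.\<close>

lemma tm_factor_parity:
  assumes "4 \<le> m"
  shows "tm_factor m (2 * i) \<noteq> tm_factor m (Suc (2 * j))"
proof
  assume "tm_factor m (2 * i) = tm_factor m (Suc (2 * j))"
  then have eq: "tm (2 * i + k) = tm (Suc (2 * j) + k)" if "k < 4" for k
    using that assms by (simp add: tm_factor_eq_iff)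
  have "tm (2 * i) = tm (Suc (2 * j))" "tm (Suc (2 * i)) = tm (2 * Suc j)"
    "tm (2 * Suc i) = tm (Suc (2 * Suc j))" "tm (Suc (2 * Suc i)) = tm (2 * Suc (Suc j))"
    using eq[of 0] eq[of 1] eq[of 2] eq[of 3] by (simp_all add: eval_nat_numeral)
  then show False
    using tm_no_cube[of j] tm_cases[of i] tm_cases[of "Suc i"]
      tm_cases[of j] tm_cases[of "Suc j"] tm_cases[of "Suc (Suc j)"]
    unfolding tm_double tm_double_Suc by (auto simp: eval_nat_numeral)
qed

lemma tm_eq_iff_halves:
  "tm (2 * i + k) = tm (2 * j + k) \<longleftrightarrow> tm (i + k div 2) = tm (j + k div 2)"
proof (cases "even k")
  case True
  then obtain l where "k = 2 * l" by blast
  then show ?thesis using tm_double[of "i + l"] tm_double[of "j + l"] by (simp add: distrib_left)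
next
  case False
  then obtain l where k: "k = Suc (2 * l)" by (metis oddE add.commute plus_1_eq_Suc)
  have "tm (2 * i + k) = 1 - tm (i + l)" for i
    using tm_double_Suc[of "i + l"] by (simp add: k distrib_left)
  then show ?thesis
    using tm_cases[of "i + l"] tm_cases[of "j + l"] by (auto simp: k)
qed

lemma card_range_cong:
  assumes "\<And>x y. f x = f y \<longleftrightarrow> g x = g y"
  shows "card (range f) = card (range g)"
proof (rule bij_betw_same_card)
  have "(\<lambda>y. g (inv f y)) (f x) = g x" for x
    using assms by (metis f_inv_into_f rangeI)
  then show "bij_betw (\<lambda>y. g (inv f y)) (range f) (range g)"
    using assms by (auto simp: bij_betw_def inj_on_def image_image)
qed

text \<open>The letters at positions \<open>2i + d, \<dots>, 2i + d + m - 1\<close> determine, and are determined by, the letters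
  at the halves of these positions, of which there are \<open>n\<close>.\<close>

lemma card_even_odd_factors:
  assumes "\<And>k. k < n \<longleftrightarrow> (\<exists>l<m. (l + d) div 2 = k)"
  shows "card (range (\<lambda>i. tm_factor m (2 * i + d))) = tm_complexity n"
  unfolding tm_complexity_def
proof (rule card_range_cong)
  fix i j
  have "tm_factor m (2 * i + d) = tm_factor m (2 * j + d) \<longleftrightarrow>
      (\<forall>l<m. tm (i + (l + d) div 2) = tm (j + (l + d) div 2))"
    unfolding tm_factor_eq_iff by (simp add: tm_eq_iff_halves add.assoc add.commute[of d])
  also have "\<dots> \<longleftrightarrow> tm_factor n i = tm_factor n j"
    unfolding tm_factor_eq_iff using assms by auto
  finally show "tm_factor m (2 * i + d) = tm_factor m (2 * j + d) \<longleftrightarrow> tm_factor n i = tm_factor n j" .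
qed

text \<open>The two summands count the subwords at even and at odd positions.\<close>

lemma tm_complexity_split:
  assumes "4 \<le> m"
  shows "tm_complexity m = tm_complexity ((m + 1) div 2) + tm_complexity ((m + 2) div 2)"
proof -
  let ?E = "range (\<lambda>i. tm_factor m (2 * i + 0))" and ?O = "range (\<lambda>i. tm_factor m (2 * i + 1))"
  have half: "k < (m + d + 1) div 2 \<longleftrightarrow> (\<exists>l<m. (l + d) div 2 = k)" if "d \<le> 1" for k d :: nat
  proof
    assume k: "k < (m + d + 1) div 2"
    show "\<exists>l<m. (l + d) div 2 = k"
      using k assms that by (intro exI[of _ "if k = 0 then 0 else 2 * k - d"]) auto
  next
    assume "\<exists>l<m. (l + d) div 2 = k"
    then show "k < (m + d + 1) div 2" using that by auto
  qed
  have "range (tm_factor m) = ?E \<union> ?O"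
  proof -
    have "tm_factor m i \<in> ?E \<union> ?O" for i
    proof (cases "even i")
      case True
      then obtain j where "i = 2 * j" by blast
      then show ?thesis by auto
    next
      case False
      then obtain j where "i = 2 * j + 1" by (rule oddE)
      then show ?thesis by auto
    qed
    then show ?thesis by auto
  qed
  moreover have "?E \<inter> ?O = {}"
    using tm_factor_parity[OF assms] by auto
  moreover have "finite ?E" "finite ?O"
    by (rule finite_subset[OF _ finite_range_tm_factor[of m]], blast)+
  ultimately have "tm_complexity m = card ?E + card ?O"
    by (simp add: tm_complexity_def card_Un_disjoint)
  then show ?thesis
    using card_even_odd_factors[OF half[of 0]] card_even_odd_factors[OF half[of 1]] by (simp add: add.commute)
qed

lemma tm_complexity_even: "2 \<le> n \<Longrightarrow> tm_complexity (2 * n) = tm_complexity n + tm_complexity (n + 1)"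
  using tm_complexity_split[of "2 * n"] by simp

lemma tm_complexity_odd: "2 \<le> n \<Longrightarrow> tm_complexity (2 * n + 1) = 2 * tm_complexity (n + 1)"
  using tm_complexity_split[of "2 * n + 1"] by simp

text \<open>The recurrences reduce the second difference at 4 to \<open>2 p(2) - p(3)\<close>, which must not vanish.
  All four words of length 2 occur, but \<open>000\<close> is not a subword, so \<open>p(2) = 4\<close> and \<open>p(3) < 8\<close>.\<close>

lemma tm_complexity_3_less: "tm_complexity 3 < 2 * tm_complexity 2"
proof -
  have v: "tm 0 = 0" "tm 1 = 1" "tm 2 = 1" "tm 3 = 0" "tm 4 = 1" "tm 5 = 0" "tm 6 = 0"
    by (simp_all add: tm_def digit_sum2.simps)
  have "{[0,1], [1,1], [1,0], [0,0]} = tm_factor 2 ` {0, 1, 2, 5}"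
    using v by (simp add: tm_factor_def upt_rec eval_nat_numeral)
  then have "card {[0::nat,1], [1,1], [1,0], [0,0]} \<le> tm_complexity 2"
    unfolding tm_complexity_def by (intro card_mono finite_range_tm_factor) auto
  moreover have "card (range (tm_factor 3)) < card {u \<in> lists {0, 1 :: nat}. length u = 3}"
  proof (intro psubset_card_mono finite_binary_words psubsetI range_tm_factor_subset)
    have "[0, 0, 0] \<noteq> tm_factor 3 i" for i
      using tm_no_cube[of i] by (auto simp: tm_factor_def upt_rec eval_nat_numeral)
    then have "[0, 0, 0] \<notin> range (tm_factor 3)" by blast
    moreover have "[0, 0, 0] \<in> {u \<in> lists {0, 1 :: nat}. length u = 3}" by simp
    ultimately show "range (tm_factor 3) \<noteq> {u \<in> lists {0, 1 :: nat}. length u = 3}" by blast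
  qed
  ultimately show ?thesis
    using card_binary_words[of 3] by (simp add: tm_complexity_def)
qed

definition tm_second_difference :: "nat \<Rightarrow> rat" where
  "tm_second_difference n =
     of_nat (tm_complexity (n + 2)) - 2 * of_nat (tm_complexity (n + 1)) + of_nat (tm_complexity n)"

lemma tm_second_difference_even:
  "2 \<le> n \<Longrightarrow> tm_second_difference (2 * n) = tm_second_difference n"
  using tm_complexity_even[of n] tm_complexity_even[of "n + 1"] tm_complexity_odd[of n]
  by (simp add: tm_second_difference_def)

lemma tm_second_difference_odd:
  "2 \<le> n \<Longrightarrow> tm_second_difference (2 * n + 1) = 0"
  using tm_complexity_odd[of n] tm_complexity_even[of "n + 1"] tm_complexity_odd[of "n + 1"]
  by (simp add: tm_second_difference_def eval_nat_numeral)

lemma tm_second_difference_4: "tm_second_difference 4 \<noteq> 0"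
proof -
  have "tm_second_difference 4 = 2 * of_nat (tm_complexity 2) - of_nat (tm_complexity 3)"
    using tm_complexity_even[of 2] tm_second_difference_even[of 2]
    by (simp add: tm_second_difference_def)
  moreover have "(of_nat (tm_complexity 3) :: rat) < of_nat (2 * tm_complexity 2)"
    using tm_complexity_3_less by (simp only: of_nat_less_iff)
  ultimately show ?thesis by simp
qed

section \<open>Algebraic solutions of Mahler equations are rational\<close>

definition fps_square_subst :: "'a::idom fps \<Rightarrow> 'a fps" where
  "fps_square_subst f = fps_compose f (fps_X ^ 2)"

definition poly_square_subst :: "'a::idom poly \<Rightarrow> 'a poly" where
  "poly_square_subst p = pcompose p (monom 1 2)"

lemma fps_square_subst_nth:
  "fps_nth (fps_square_subst f) n = (if even n then fps_nth f (n div 2) else 0)"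
proof -
  have "fps_nth (fps_square_subst f) n = (\<Sum>i=0..n. fps_nth f i * (if n = 2 * i then 1 else 0))"
    by (simp add: fps_square_subst_def fps_compose_nth fps_X_power_nth flip: power_mult)
  also have "\<dots> = (\<Sum>i=0..n. if i = n div 2 \<and> even n then fps_nth f i else 0)"
    by (intro sum.cong) auto
  finally show ?thesis by (simp add: sum.delta)
qed

lemma fps_square_subst_add: "fps_square_subst (f + g) = fps_square_subst f + fps_square_subst g"
  by (simp add: fps_square_subst_def fps_compose_add_distrib)

lemma fps_square_subst_diff: "fps_square_subst (f - g) = fps_square_subst f - fps_square_subst g"
  by (simp add: fps_square_subst_def fps_compose_sub_distrib)

lemma fps_square_subst_mult: "fps_square_subst (f * g) = fps_square_subst f * fps_square_subst g"
  by (simp add: fps_square_subst_def fps_compose_mult_distrib)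

lemma fps_square_subst_fps_of_poly:
  "fps_square_subst (fps_of_poly p) = fps_of_poly (poly_square_subst p)"
  by (simp add: fps_square_subst_def poly_square_subst_def fps_of_poly_pcompose fps_of_poly_monom')

lemma poly_square_subst_eq_0_iff [simp]: "poly_square_subst p = 0 \<longleftrightarrow> p = 0"
  by (simp add: poly_square_subst_def pcompose_eq_0_iff degree_monom_eq)

lemma subdegree_fps_square_subst: "subdegree (fps_square_subst f) = 2 * subdegree f"
  by (simp add: fps_square_subst_def)

lemma fps_square_subst_eval_fps:
  "fps_square_subst (eval_fps Q f) = eval_fps (map_poly poly_square_subst Q) (fps_square_subst f)"
  by (induction Q)
    (simp_all add: map_poly_pCons fps_square_subst_add fps_square_subst_mult fps_square_subst_fps_of_poly,
      simp add: fps_square_subst_def)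

text \<open>In terms of Laurent series, \<open>w / A\<close> is invariant under \<open>x \<mapsto> x\<^sup>2\<close>. This substitution doubles
  orders, so an invariant series is a constant.\<close>

lemma fps_square_subst_semi_invariant:
  fixes w :: "'a::field fps"
  assumes "A \<noteq> 0" and eq: "w * fps_square_subst A = A * fps_square_subst w"
  shows "\<exists>c. w = fps_const c * A"
proof -
  \<comment> \<open>Comparing orders in the equation shows that every nonzero solution has the order of \<open>A\<close>.\<close>
  have order: "v = 0 \<or> subdegree v = subdegree A"
    if "v * fps_square_subst A = A * fps_square_subst v" for v
  proof (cases "v = 0")
    case False
    have nz: "fps_square_subst u \<noteq> 0" if "u \<noteq> 0" for u :: "'a fps"
      using that unfolding fps_square_subst_def by (subst fps_compose_eq_0_iff) auto
    have "subdegree v + 2 * subdegree A = subdegree A + 2 * subdegree v"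
      using arg_cong[OF that, of subdegree] False assms(1) nz
      by (simp add: subdegree_fps_square_subst)
    then show ?thesis by simp
  qed simp
  \<comment> \<open>With this \<open>c\<close> the leading terms cancel, so \<open>w - c A\<close> is a solution of higher order.\<close>
  define c where "c = fps_nth w (subdegree A) / fps_nth A (subdegree A)"
  define v where "v = w - fps_const c * A"
  have const: "fps_square_subst (fps_const c) = fps_const c"
    by (simp add: fps_square_subst_def)
  have "v * fps_square_subst A = A * fps_square_subst v"
    by (simp add: v_def fps_square_subst_diff fps_square_subst_mult const eq algebra_simps)
  moreover have "fps_nth v (subdegree A) = 0"
    using assms(1) by (simp add: v_def c_def)
  ultimately have "v = 0"
    using order[of v] nth_subdegree_nonzero[of v] by metis
  then show ?thesis by (auto simp: v_def)
qed

lemma lead_coeff_pcompose_translate: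
  fixes P :: "'a::comm_ring_1 poly"
  assumes "degree P \<le> n"
  shows "coeff (pcompose P [:c, 1:]) n = coeff P n"
  using assms
proof (induction n arbitrary: P)
  case 0
  then obtain a where "P = [:a:]" by (auto elim: degree_eq_zeroE)
  then show ?case by simp
next
  case (Suc n)
  obtain a R where P: "P = pCons a R" by (cases P)
  then have R: "degree R \<le> n" using Suc.prems by (simp split: if_splits)
  then have "degree (pcompose R [:c, 1:]) < Suc n"
    using degree_pcompose_le[of R "[:c, 1:]"] by simp
  then have "coeff (pcompose R [:c, 1:]) (Suc n) = 0" by (rule coeff_eq_0)
  then show ?case using Suc.IH[OF R] by (simp add: P pcompose_pCons)
qed

lemma coeff_pcompose_translate:
  fixes P :: "'a::comm_ring_1 poly"
  assumes "degree P \<le> Suc n"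
  shows "coeff (pcompose P [:c, 1:]) n = coeff P n + of_nat (Suc n) * c * coeff P (Suc n)"
  using assms
proof (induction n arbitrary: P)
  case 0
  obtain a R where P: "P = pCons a R" by (cases P)
  then have "degree R = 0" using 0 by (simp split: if_splits)
  then obtain r where "R = [:r:]" by (auto elim: degree_eq_zeroE)
  then show ?case by (simp add: P pcompose_pCons)
next
  case (Suc n)
  obtain a R where P: "P = pCons a R" by (cases P)
  then have R: "degree R \<le> Suc n" using Suc.prems by (simp split: if_splits)
  show ?case
    using Suc.IH[OF R] lead_coeff_pcompose_translate[OF R, of c]
    by (simp add: P pcompose_pCons algebra_simps)
qed

text \<open>Let \<open>Q = a y\<^sup>d + e y\<^sup>d\<^sup>-\<^sup>1 + \<dots>\<close> be a polynomial of minimal degree that vanishes at \<open>h\<close>. Substituting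
  \<open>x\<^sup>2\<close> for \<open>x\<close> and \<open>h - q\<close> for \<open>h(x\<^sup>2)\<close> gives another polynomial of degree \<open>d\<close> that vanishes at \<open>h\<close>,
  so it is proportional to \<open>Q\<close>. Comparing the coefficients of \<open>y\<^sup>d\<^sup>-\<^sup>1\<close> shows that the rational function
  \<open>b = - e / (d a)\<close> satisfies the same equation \<open>b(x) = b(x\<^sup>2) + q(x)\<close> as \<open>h\<close>. So \<open>h - b\<close> is invariant under
  \<open>x \<mapsto> x\<^sup>2\<close> and hence constant.\<close>

theorem rational_if_algebraic_mahler:
  fixes h :: "'a::field_char_0 fps"
  assumes alg: "algebraic_fps h" and mahler: "h = fps_square_subst h + fps_of_poly q"
  shows "\<exists>A B. A \<noteq> 0 \<and> fps_of_poly A * h = fps_of_poly B"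
proof -
  define Q where "Q = arg_min degree (\<lambda>Q. Q \<noteq> 0 \<and> eval_fps Q h = 0)"
  obtain Q0 where "Q0 \<noteq> 0 \<and> eval_fps Q0 h = 0"
    using alg by (auto simp: algebraic_fps_def)
  then have Q: "Q \<noteq> 0" "eval_fps Q h = 0"
    and minimal: "\<And>P. P \<noteq> 0 \<Longrightarrow> eval_fps P h = 0 \<Longrightarrow> degree Q \<le> degree P"
    unfolding Q_def
    using arg_min_nat_lemma[where P = "\<lambda>Q. Q \<noteq> 0 \<and> eval_fps Q h = 0" and m = degree] by auto
  define d where "d = degree Q"
  define a where "a = lead_coeff Q"
  have a: "a \<noteq> 0" "coeff Q d = a" using Q by (simp_all add: a_def d_def)
  have d: "d \<noteq> 0"
  proof
    assume "d = 0"
    then obtain c where "Q = [:c:]" by (auto simp: d_def elim: degree_eq_zeroE)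
    with Q show False using fps_of_poly_eq_iff[of c 0] by simp
  qed
  define Q2 where "Q2 = map_poly poly_square_subst Q"
  have coeffQ2: "coeff Q2 i = poly_square_subst (coeff Q i)" for i
    by (simp add: Q2_def coeff_map_poly)
  have degQ2: "degree Q2 = d"
    unfolding Q2_def d_def by (rule degree_map_poly) simp
  define P where "P = pcompose Q2 [:- q, 1:]"
  have "fps_square_subst h = eval_fps [:- q, 1:] h"
    using mahler by (simp add: fps_of_poly_uminus algebra_simps)
  then have P: "eval_fps P h = 0"
    using fps_square_subst_eval_fps[of Q h] Q(2)
    by (simp add: P_def eval_fps_pcompose Q2_def) (simp add: fps_square_subst_def)
  have degP: "degree P = d" by (simp add: P_def degQ2 degree_pcompose)
  have lcP: "coeff P d = poly_square_subst a"
    using lead_coeff_comp[of "[:- q, 1:]" Q2] degP degQ2 a coeffQ2 by (simp add: P_def)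
  have subP: "coeff P (d - 1) = poly_square_subst (coeff Q (d - 1)) - of_nat d * q * poly_square_subst a"
    using coeff_pcompose_translate[of Q2 "d - 1" "- q"] degQ2 d a by (simp add: P_def coeffQ2)
  have "smult (poly_square_subst a) Q - smult a P = 0"
  proof (rule ccontr)
    assume nz: "smult (poly_square_subst a) Q - smult a P \<noteq> 0" (is "?D \<noteq> 0")
    have "eval_fps ?D h = 0" using P Q(2) by (simp add: eval_fps_diff eval_fps_smult)
    then have "d \<le> degree ?D" using minimal[OF nz] by (simp add: d_def)
    moreover have "degree ?D \<le> d"
      by (intro degree_diff_le) (simp_all add: degP d_def)
    ultimately have "coeff ?D d \<noteq> 0" using nz leading_coeff_0_iff[of ?D] by simp
    then show False by (simp add: lcP a)
  qed
  then have "poly_square_subst a * coeff Q (d - 1) = a * coeff P (d - 1)"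
    by (metis coeff_smult eq_iff_diff_eq_0)
  then have key: "poly_square_subst a * coeff Q (d - 1) =
      a * (poly_square_subst (coeff Q (d - 1)) - of_nat d * q * poly_square_subst a)"
    by (simp only: subP)
  \<comment> \<open>\<open>B / A\<close> is the rational function \<open>b\<close>.\<close>
  define A where "A = smult (of_nat d) a"
  define B where "B = - coeff Q (d - 1)"
  define w where "w = fps_of_poly A * h - fps_of_poly B"
  have A: "A \<noteq> 0" using a d by (simp add: A_def)
  have "w * fps_square_subst (fps_of_poly A) = fps_of_poly A * fps_square_subst w"
  proof -
    let ?a2 = "poly_square_subst a" and ?e = "coeff Q (d - 1)"
    have A2: "poly_square_subst A = of_nat d * ?a2"
      by (simp add: A_def poly_square_subst_def pcompose_smult of_nat_poly)
    have B2: "poly_square_subst B = - poly_square_subst ?e"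
      by (simp add: B_def poly_square_subst_def pcompose_uminus)
    have A': "A = of_nat d * a" by (simp add: A_def of_nat_poly)
    have h2: "fps_square_subst h = h - fps_of_poly q" using mahler by (simp add: algebra_simps)
    have "w * fps_square_subst (fps_of_poly A) - fps_of_poly A * fps_square_subst w
        = fps_of_poly (A * poly_square_subst A * q + A * poly_square_subst B - B * poly_square_subst A)"
      unfolding w_def fps_square_subst_diff fps_square_subst_mult fps_square_subst_fps_of_poly h2
      by (simp add: fps_of_poly_add fps_of_poly_diff fps_of_poly_mult algebra_simps)
    also have "A * poly_square_subst A * q + A * poly_square_subst B - B * poly_square_subst A
        = of_nat d * (?a2 * ?e - a * (poly_square_subst ?e - of_nat d * q * ?a2))"
      unfolding A2 B2 by (simp add: A' B_def algebra_simps)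
    also have "\<dots> = 0" using key by simp
    finally show ?thesis by simp
  qed
  then obtain c where "w = fps_const c * fps_of_poly A"
    using fps_square_subst_semi_invariant[of "fps_of_poly A" w] A fps_of_poly_eq_iff[of A 0] by auto
  then have "fps_of_poly A * h = fps_of_poly (B + smult c A)"
    by (simp add: w_def fps_of_poly_add fps_of_poly_smult algebra_simps)
  with A show ?thesis by blast
qed

section \<open>The words that are not subwords\<close>

text \<open>If \<open>N\<close> is followed by a gap longer than the degree of \<open>A\<close>, then the coefficient of \<open>A h\<close> at
  \<open>N + degree A\<close> consists of the single product of the leading coefficient of \<open>A\<close> and the coefficient
  of \<open>h\<close> at \<open>N\<close>.\<close>

lemma not_rational_if_gaps:
  fixes h :: "'a::idom fps"
  assumes gaps: "\<And>m. \<exists>N>m. fps_nth h N \<noteq> 0 \<and> (\<forall>i\<in>{1..m}. fps_nth h (N + i) = 0)"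
    and "A \<noteq> 0"
  shows "fps_of_poly A * h \<noteq> fps_of_poly B"
proof
  assume eq: "fps_of_poly A * h = fps_of_poly B"
  let ?d = "degree A"
  obtain N where N: "N > max ?d (degree B)" "fps_nth h N \<noteq> 0"
      "\<forall>i\<in>{1..max ?d (degree B)}. fps_nth h (N + i) = 0"
    using gaps by blast
  have "fps_nth (fps_of_poly A * h) (N + ?d) = (\<Sum>j=0..N + ?d. coeff A j * fps_nth h (N + ?d - j))"
    by (simp add: fps_mult_nth)
  also have "\<dots> = (\<Sum>j\<in>{?d}. coeff A j * fps_nth h (N + ?d - j))"
  proof (rule sum.mono_neutral_right, simp, simp, rule ballI)
    fix j assume j: "j \<in> {0..N + ?d} - {?d}"
    show "coeff A j * fps_nth h (N + ?d - j) = 0"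
    proof (cases "j < ?d")
      case True
      then have "N + ?d - j = N + (?d - j)" "?d - j \<in> {1..max ?d (degree B)}" by auto
      with N(3) show ?thesis by simp
    next
      case False
      with j show ?thesis by (simp add: coeff_eq_0)
    qed
  qed
  also have "\<dots> \<noteq> 0" using N(2) assms(2) by simp
  finally show False using N(1) by (simp add: eq coeff_eq_0)
qed

text \<open>Such an \<open>n\<close> is not a multiple of \<open>2\<^sup>k\<close>, so halving it at most \<open>k\<close> times leads to an odd number, and this
  number is greater than 4.\<close>

lemma tm_second_difference_gap:
  assumes "4 * 2 ^ k < n" "n < 5 * 2 ^ k"
  shows "tm_second_difference n = 0"
  using assms
proof (induction k arbitrary: n)
  case (Suc k)
  show ?case
  proof (cases "even n")
    case True
    then obtain m where n: "n = 2 * m" by blast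
    have "4 * 2 ^ k < m" "m < 5 * 2 ^ k" using Suc.prems by (simp_all add: n)
    moreover have "(1::nat) \<le> 2 ^ k" by simp
    ultimately show ?thesis using Suc.IH[of m] tm_second_difference_even[of m] by (simp add: n)
  next
    case False
    then obtain m where n: "n = 2 * m + 1" by (rule oddE)
    have "(1::nat) \<le> 2 ^ k" by simp
    then have "2 \<le> m" using Suc.prems(1) unfolding n power_Suc by linarith
    then show ?thesis using tm_second_difference_odd[of m] by (simp add: n)
  qed
qed simp

lemma tm_second_difference_peak: "tm_second_difference (4 * 2 ^ k) \<noteq> 0"
proof (induction k)
  case (Suc k)
  have "(1::nat) \<le> 2 ^ k" by simp
  then have "2 \<le> 4 * (2::nat) ^ k" by linarith
  then show ?case using tm_second_difference_even[of "4 * 2 ^ k"] Suc by simp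
qed (simp add: tm_second_difference_4)

lemma poly_of_finite_support:
  assumes "\<And>n. d \<le> n \<Longrightarrow> fps_nth f n = (0::'a::comm_ring_1)"
  shows "\<exists>q. f = fps_of_poly q"
proof -
  have "coeff (\<Sum>i<d. monom (fps_nth f i) i) n = fps_nth f n" for n
    using assms[of n] by (simp add: coeff_sum coeff_monom not_less)
  then have "f = fps_of_poly (\<Sum>i<d. monom (fps_nth f i) i)"
    by (simp add: fps_eq_iff)
  then show ?thesis by blast
qed

theorem tm_second_difference_not_algebraic:
  "\<not> algebraic_fps (Abs_fps tm_second_difference)"
proof
  define h where "h = Abs_fps tm_second_difference"
  assume "algebraic_fps (Abs_fps tm_second_difference)"
  then have alg: "algebraic_fps h" by (simp add: h_def)
  have "fps_nth (h - fps_square_subst h) n = 0" if n: "4 \<le> n" for n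
  proof (cases "even n")
    case True
    then obtain m where "n = 2 * m" by blast
    with n show ?thesis using tm_second_difference_even[of m]
      by (simp add: h_def fps_square_subst_nth)
  next
    case False
    then obtain m where "n = 2 * m + 1" by (rule oddE)
    with n show ?thesis using tm_second_difference_odd[of m]
      by (simp add: h_def fps_square_subst_nth)
  qed
  then obtain q where "h - fps_square_subst h = fps_of_poly q"
    using poly_of_finite_support by blast
  then have "h = fps_square_subst h + fps_of_poly q" by (simp add: algebra_simps)
  with alg obtain A B where AB: "A \<noteq> 0" "fps_of_poly A * h = fps_of_poly B"
    using rational_if_algebraic_mahler by blast
  have "\<exists>N>m. fps_nth h N \<noteq> 0 \<and> (\<forall>i\<in>{1..m}. fps_nth h (N + i) = 0)" for m
  proof (intro exI conjI ballI)
    have m: "m < 2 ^ m" by simp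
    then show "m < 4 * 2 ^ m" by linarith
    show "fps_nth h (4 * 2 ^ m) \<noteq> 0" using tm_second_difference_peak by (simp add: h_def)
    fix i assume "i \<in> {1..m}"
    then have "0 < i" "i < 2 ^ m" using le_less_trans[OF _ m, of i] by auto
    then show "fps_nth h (4 * 2 ^ m + i) = 0"
      using tm_second_difference_gap[of m "4 * 2 ^ m + i"] by (simp add: h_def)
  qed
  then show False using not_rational_if_gaps AB by blast
qed

text \<open>Up to a polynomial, the series of the second differences of \<open>p\<close> is a rational multiple of \<open>F\<close>, because
  \<open>F\<close> is the series of \<open>2\<^sup>n - p(n)\<close>.\<close>

theorem non_subword_series_not_algebraic:
  "\<not> algebraic_fps (Abs_fps (\<lambda>m.
      rat_of_nat (card {u \<in> {u \<in> lists {0, 1}. \<not> subword u thue_morse}. length u = m})))"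
proof
  define F where "F = Abs_fps (\<lambda>m.
      rat_of_nat (card {u \<in> {u \<in> lists {0, 1}. \<not> subword u thue_morse}. length u = m}))"
  assume "algebraic_fps (Abs_fps (\<lambda>m.
      rat_of_nat (card {u \<in> {u \<in> lists {0, 1}. \<not> subword u thue_morse}. length u = m})))"
  then have alg: "algebraic_fps F" by (simp add: F_def)
  define h where "h = Abs_fps tm_second_difference"
  \<comment> \<open>These are \<open>(1 - x)\<^sup>2 (1 - 2x)\<close> and \<open>- x\<^sup>2 (1 - 2x)\<close>: the factor \<open>(1 - x)\<^sup>2\<close> takes second differences
    shifted by \<open>x\<^sup>2\<close>, and \<open>1 - 2x\<close> removes the contribution of \<open>2\<^sup>n\<close>.\<close>
  let ?b = "[:1, - 4, 5, - 2 :: rat:]" and ?c = "[:0, 0, - 1, 2 :: rat:]"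
  have nF: "fps_nth F n = 2 ^ n - of_nat (tm_complexity n)" for n
  proof -
    have "rat_of_nat (card {u \<in> {u \<in> lists {0, 1}. \<not> subword u thue_morse}. length u = n} + tm_complexity n)
        = rat_of_nat (2 ^ n)"
      by (simp only: card_non_subwords)
    then show ?thesis by (simp add: F_def)
  qed
  have lin: "fps_nth (fps_of_poly [:a0, a1, a2, a3:] * f) (m + 4)
      = a0 * fps_nth f (m + 4) + a1 * fps_nth f (m + 3) + a2 * fps_nth f (m + 2) + a3 * fps_nth f (m + 1)"
    for a0 a1 a2 a3 :: rat and f m
  proof -
    have "fps_of_poly [:a0, a1, a2, a3:] * f = fps_const a0 * f + fps_const a1 * (fps_X ^ 1 * f)
        + fps_const a2 * (fps_X ^ 2 * f) + fps_const a3 * (fps_X ^ 3 * f)"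
      by (simp add: fps_of_poly_pCons algebra_simps power2_eq_square power3_eq_cube)
    also have "fps_nth \<dots> (m + 4)
        = a0 * fps_nth f (m + 4) + a1 * fps_nth f (m + 3) + a2 * fps_nth f (m + 2) + a3 * fps_nth f (m + 1)"
      unfolding fps_add_nth fps_mult_left_const_nth fps_X_power_mult_nth by (simp add: add.commute)
    finally show ?thesis .
  qed
  have "fps_nth (fps_of_poly ?b * F - fps_of_poly ?c * h) n = 0" if "4 \<le> n" for n
  proof -
    obtain m where n: "n = m + 4" using \<open>4 \<le> n\<close> by (metis le_add_diff_inverse2)
    show ?thesis
      unfolding n fps_sub_nth lin nF
      by (simp add: h_def tm_second_difference_def eval_nat_numeral)
  qed
  then obtain a where "fps_of_poly ?b * F - fps_of_poly ?c * h = fps_of_poly a"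
    using poly_of_finite_support by blast
  then have "algebraic_fps h"
    by (intro algebraic_fps_of_affine[OF alg, where b = ?b and c = ?c and a = a])
      (simp_all add: algebra_simps)
  then show False using tm_second_difference_not_algebraic by (simp add: h_def)
qed

section \<open>Generating functions of parse trees\<close>

definition graded_gf :: "('x \<Rightarrow> nat) \<Rightarrow> ('x \<Rightarrow> 'r::comm_ring_1) \<Rightarrow> 'x set \<Rightarrow> 'r fps" where
  "graded_gf sz wt X = Abs_fps (\<lambda>m. \<Sum>x\<in>{x \<in> X. sz x = m}. wt x)"

text \<open>Finiteness of the graded pieces matters here: sums over infinite sets are 0 by convention, and
  the product formula would fail.\<close>

lemma graded_gf_Times:
  assumes fin: "\<And>m. finite {x \<in> X. szx x = m}" "\<And>m. finite {y \<in> Y. szy y = m}"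
  shows "graded_gf (\<lambda>(x, y). szx x + szy y) (\<lambda>(x, y). wx x * wy y) (X \<times> Y)
      = graded_gf szx wx X * graded_gf szy wy Y"
proof (rule fps_ext)
  fix m
  let ?X = "\<lambda>i. {x \<in> X. szx x = i}" and ?Y = "\<lambda>i. {y \<in> Y. szy y = i}"
  have "{p \<in> X \<times> Y. (\<lambda>(x, y). szx x + szy y) p = m} = (\<Union>i\<in>{0..m}. ?X i \<times> ?Y (m - i))"
    by auto
  then have "fps_nth (graded_gf (\<lambda>(x, y). szx x + szy y) (\<lambda>(x, y). wx x * wy y) (X \<times> Y)) m
      = (\<Sum>i=0..m. \<Sum>(x, y)\<in>?X i \<times> ?Y (m - i). wx x * wy y)"
    unfolding graded_gf_def by (simp, subst sum.UNION_disjoint) (use fin in auto)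
  also have "\<dots> = (\<Sum>i=0..m. sum wx (?X i) * sum wy (?Y (m - i)))"
    by (simp add: sum_product sum.cartesian_product)
  finally show "fps_nth (graded_gf (\<lambda>(x, y). szx x + szy y) (\<lambda>(x, y). wx x * wy y) (X \<times> Y)) m
      = fps_nth (graded_gf szx wx X * graded_gf szy wy Y) m"
    by (simp add: fps_mult_nth graded_gf_def)
qed

lemma graded_gf_bij:
  assumes "bij_betw f X Y" and "\<And>x. x \<in> X \<Longrightarrow> sz' (f x) = sz x" and "\<And>x. x \<in> X \<Longrightarrow> wt' (f x) = wt x"
  shows "graded_gf sz' wt' Y = graded_gf sz wt X"
proof (rule fps_ext)
  fix m
  have "bij_betw f {x \<in> X. sz x = m} {y \<in> Y. sz' y = m}"
    using assms(1,2) by (auto simp: bij_betw_def intro: inj_on_subset)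
  then show "fps_nth (graded_gf sz' wt' Y) m = fps_nth (graded_gf sz wt X) m"
    unfolding graded_gf_def using assms(3) by (simp, subst sum.reindex_bij_betw[symmetric]) auto
qed

fun node_count :: "('n, 'a) parse_tree \<Rightarrow> nat" where
  "node_count (Leaf a) = 0"
| "node_count (Node A ts) = Suc (sum_list (map node_count ts))"

text \<open>The weight records what the grading by nodes forgets: each leaf contributes \<open>x\<close> and
  each use of a production \<open>p\<close> contributes \<open>\<omega> p\<close>.\<close>

fun tree_weight ::
    "('n \<times> ('n, 'a) symbol list \<Rightarrow> 'r) \<Rightarrow> 'r \<Rightarrow> ('n, 'a) parse_tree \<Rightarrow> 'r::comm_ring_1" where
  "tree_weight \<omega> x (Leaf a) = x"
| "tree_weight \<omega> x (Node A ts) = \<omega> (A, map root_symbol ts) * prod_list (map (tree_weight \<omega> x) ts)"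

definition trees :: "('n, 'a) cfg \<Rightarrow> ('n, 'a) symbol \<Rightarrow> ('n, 'a) parse_tree set" where
  "trees G s = {t. conforms G t \<and> root_symbol t = s}"

definition forests :: "('n, 'a) cfg \<Rightarrow> ('n, 'a) symbol list \<Rightarrow> ('n, 'a) parse_tree list set" where
  "forests G \<alpha> = {ts. map root_symbol ts = \<alpha> \<and> (\<forall>t\<in>set ts. conforms G t)}"

abbreviation forest_size :: "('n, 'a) parse_tree list \<Rightarrow> nat" where
  "forest_size ts \<equiv> sum_list (map node_count ts)"

lemma root_symbol_Tm_iff: "root_symbol t = Tm a \<longleftrightarrow> t = Leaf a"
  by (cases t) auto

lemma trees_Tm: "trees G (Tm a) = {Leaf a}"
  by (auto simp: trees_def root_symbol_Tm_iff)

lemma trees_Nt: "trees G (Nt A) = (\<Union>\<alpha>\<in>{\<alpha>. (A, \<alpha>) \<in> productions G}. Node A ` forests G \<alpha>)"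
proof -
  have "t \<in> trees G (Nt A) \<longleftrightarrow> (\<exists>\<alpha>. (A, \<alpha>) \<in> productions G \<and> t \<in> Node A ` forests G \<alpha>)" for t
    by (cases t) (auto simp: trees_def forests_def)
  then show ?thesis by auto
qed

lemma forests_Nil: "forests G [] = {[]}"
  by (auto simp: forests_def)

lemma forests_Cons: "forests G (s # \<alpha>) = (\<lambda>(t, ts). t # ts) ` (trees G s \<times> forests G \<alpha>)"
  by (auto simp: forests_def trees_def map_eq_Cons_conv image_iff)

lemma finite_rules: "wf_cfg G \<Longrightarrow> finite {\<alpha>. (A, \<alpha>) \<in> productions G}"
  by (rule finite_subset[of _ "snd ` productions G"]) (force, simp add: wf_cfg_def)

text \<open>Counting nodes bounds the trees even if the grammar has empty productions or cycles
  \<open>A \<rightarrow> B \<rightarrow> A\<close>, which allow infinitely many trees for one word. This is why trees are graded by their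
  number of inner nodes and the length of the word is only recorded in the weight.\<close>

lemma finite_forests_le:
  assumes G: "wf_cfg G"
  shows "finite {ts \<in> forests G \<alpha>. forest_size ts \<le> m}"
proof (induction m arbitrary: \<alpha> rule: less_induct)
  case (less m)
  show ?case
  proof (induction \<alpha>)
    case Nil
    show ?case by (simp add: forests_Nil)
  next
    case (Cons s \<alpha>)
    have "finite {t \<in> trees G s. node_count t \<le> m}"
    proof (cases s)
      case (Tm a)
      then show ?thesis by (simp add: trees_Tm)
    next
      case (Nt A)
      show ?thesis
      proof (cases m)
        case 0
        have "{t \<in> trees G s. node_count t \<le> m} = {}"
          by (auto simp: Nt trees_Nt 0)
        then show ?thesis by (simp only: finite.emptyI)
      next
        case (Suc k)
        have "{t \<in> trees G s. node_count t \<le> m} =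
            (\<Union>\<beta>\<in>{\<beta>. (A, \<beta>) \<in> productions G}. Node A ` {ts \<in> forests G \<beta>. forest_size ts \<le> k})"
          by (auto simp: Nt trees_Nt Suc)
        then show ?thesis using less[of k] finite_rules[OF G] Suc by simp
      qed
    qed
    then have "finite ((\<lambda>(t, ts). t # ts) `
        ({t \<in> trees G s. node_count t \<le> m} \<times> {ts \<in> forests G \<alpha>. forest_size ts \<le> m}))"
      using Cons by blast
    then show ?case
      by (rule rev_finite_subset) (auto simp: forests_Cons)
  qed
qed

lemma finite_forests: "wf_cfg G \<Longrightarrow> finite {ts \<in> forests G \<alpha>. forest_size ts = m}"
  by (rule finite_subset[OF _ finite_forests_le[of G \<alpha> m]]) auto

lemma finite_trees:
  assumes "wf_cfg G" shows "finite {t \<in> trees G s. node_count t = m}"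
proof (rule finite_imageD)
  show "finite ((\<lambda>t. [t]) ` {t \<in> trees G s. node_count t = m})"
    by (rule finite_subset[OF _ finite_forests[OF assms, of "[s]" m]])
      (auto simp: forests_def trees_def)
qed (simp add: inj_on_def)

definition tree_gf ::
    "('n, 'a) cfg \<Rightarrow> ('n \<times> ('n, 'a) symbol list \<Rightarrow> 'r) \<Rightarrow> 'r \<Rightarrow> ('n, 'a) symbol \<Rightarrow> 'r::comm_ring_1 fps" where
  "tree_gf G \<omega> x s = graded_gf node_count (tree_weight \<omega> x) (trees G s)"

lemma tree_gf_Tm:
  fixes G :: "('n, 'a) cfg"
  shows "tree_gf G \<omega> x (Tm a) = fps_const x"
proof -
  have "{t \<in> {Leaf a :: ('n, 'a) parse_tree}. node_count t = m} = (if m = 0 then {Leaf a} else {})" for m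
    by auto
  then show ?thesis
    unfolding tree_gf_def trees_Tm graded_gf_def by (simp only: fps_eq_iff) simp
qed

lemma forest_gf:
  fixes G :: "('n, 'a) cfg"
  assumes "wf_cfg G"
  shows "graded_gf forest_size (\<lambda>ts. prod_list (map (tree_weight \<omega> x) ts)) (forests G \<alpha>)
      = prod_list (map (tree_gf G \<omega> x) \<alpha>)"
proof (induction \<alpha>)
  case Nil
  have "{ts \<in> {[] :: ('n, 'a) parse_tree list}. forest_size ts = m} = (if m = 0 then {[]} else {})" for m
    by auto
  then show ?case
    unfolding forests_Nil graded_gf_def by (simp only: fps_eq_iff) simp
next
  case (Cons s \<alpha>)
  have "graded_gf forest_size (\<lambda>ts. prod_list (map (tree_weight \<omega> x) ts)) (forests G (s # \<alpha>))
      = graded_gf (\<lambda>(t, ts). node_count t + forest_size ts)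
          (\<lambda>(t, ts). tree_weight \<omega> x t * prod_list (map (tree_weight \<omega> x) ts))
          (trees G s \<times> forests G \<alpha>)"
    by (rule graded_gf_bij[where f = "\<lambda>(t, ts). t # ts"])
      (auto simp: forests_Cons bij_betw_def inj_on_def)
  also have "\<dots> = tree_gf G \<omega> x s * prod_list (map (tree_gf G \<omega> x) \<alpha>)"
    unfolding tree_gf_def
    by (subst graded_gf_Times) (simp_all add: finite_trees finite_forests assms Cons[unfolded tree_gf_def])
  finally show ?case by simp
qed

text \<open>The polynomial system of the grammar: a tree is a root, which accounts for the factor
  \<^term>\<open>fps_X\<close>, together with a forest for one of the right-hand sides.\<close>

theorem tree_gf_Nt:
  assumes G: "wf_cfg G"
  shows "tree_gf G \<omega> x (Nt A) = fps_X *
    (\<Sum>\<alpha> | (A, \<alpha>) \<in> productions G. fps_const (\<omega> (A, \<alpha>)) * prod_list (map (tree_gf G \<omega> x) \<alpha>))"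
proof (rule fps_ext)
  fix m
  let ?R = "{\<alpha>. (A, \<alpha>) \<in> productions G}"
  show "fps_nth (tree_gf G \<omega> x (Nt A)) m = fps_nth (fps_X *
    (\<Sum>\<alpha>\<in>?R. fps_const (\<omega> (A, \<alpha>)) * prod_list (map (tree_gf G \<omega> x) \<alpha>))) m"
  proof (cases m)
    case 0
    have "{t \<in> trees G (Nt A). node_count t = 0} = {}" by (auto simp: trees_Nt)
    then have "fps_nth (tree_gf G \<omega> x (Nt A)) 0 = 0"
      unfolding tree_gf_def graded_gf_def by (simp only: fps_nth_Abs_fps sum.empty)
    then show ?thesis using 0 by simp
  next
    case (Suc k)
    let ?F = "\<lambda>\<alpha>. {ts \<in> forests G \<alpha>. forest_size ts = k}"
    have "{t \<in> trees G (Nt A). node_count t = Suc k} = (\<Union>\<alpha>\<in>?R. Node A ` ?F \<alpha>)"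
      by (auto simp: trees_Nt)
    then have "fps_nth (tree_gf G \<omega> x (Nt A)) (Suc k) = sum (tree_weight \<omega> x) (\<Union>\<alpha>\<in>?R. Node A ` ?F \<alpha>)"
      by (simp add: tree_gf_def graded_gf_def)
    also have "\<dots> = (\<Sum>\<alpha>\<in>?R. sum (tree_weight \<omega> x) (Node A ` ?F \<alpha>))"
      by (rule sum.UNION_disjoint)
        (auto simp: finite_rules[OF G] finite_forests[OF G], auto simp: forests_def)
    also have "\<dots> = (\<Sum>\<alpha>\<in>?R. \<Sum>ts\<in>?F \<alpha>. \<omega> (A, \<alpha>) * prod_list (map (tree_weight \<omega> x) ts))"
      by (intro sum.cong refl, subst sum.reindex) (auto simp: inj_on_def forests_def intro!: sum.cong)
    also have "\<dots> = (\<Sum>\<alpha>\<in>?R. \<omega> (A, \<alpha>) * fps_nth (prod_list (map (tree_gf G \<omega> x) \<alpha>)) k)"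
      unfolding forest_gf[OF G, symmetric] by (simp add: graded_gf_def sum_distrib_left)
    finally show ?thesis by (simp add: Suc fps_sum_nth)
  qed
qed

section \<open>Elimination by counting reduced monomials\<close>

text \<open>More vectors than coordinates are linearly dependent. Gaussian elimination without division
  gives a dependence with coefficients in the domain itself.\<close>

lemma fraction_free_kernel:
  fixes a :: "'k \<Rightarrow> 'j \<Rightarrow> 'c::idom"
  assumes "finite J" "finite K" "card J < card K"
  shows "\<exists>c. (\<exists>k\<in>K. c k \<noteq> 0) \<and> (\<forall>j\<in>J. (\<Sum>k\<in>K. c k * a k j) = 0)"
  using assms
proof (induction J arbitrary: K a rule: finite_induct)
  case empty
  then obtain k where "k \<in> K" by fastforce
  then show ?case by (intro exI[of _ "\<lambda>_. 1"]) auto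
next
  case (insert i J)
  show ?case
  proof (cases "\<forall>k\<in>K. a k i = 0")
    case True
    then show ?thesis using insert.IH[of K a] insert.prems insert.hyps by auto
  next
    case False
    then obtain k0 where k0: "k0 \<in> K" "a k0 i \<noteq> 0" by blast
    \<comment> \<open>Clear the coordinate \<open>i\<close> of the other vectors with the pivot vector \<open>k0\<close>.\<close>
    define K' where "K' = K - {k0}"
    have K: "K = insert k0 K'" "k0 \<notin> K'" "finite K'" using k0 insert.prems by (auto simp: K'_def)
    then have "card J < card K'" using insert by simp
    then obtain c where c: "\<exists>k\<in>K'. c k \<noteq> 0"
        "\<forall>j\<in>J. (\<Sum>k\<in>K'. c k * (a k0 i * a k j - a k i * a k0 j)) = 0"
      using insert.IH[of K' "\<lambda>k j. a k0 i * a k j - a k i * a k0 j"] K by blast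
    define c' where "c' k = (if k = k0 then - (\<Sum>k\<in>K'. c k * a k i) else c k * a k0 i)" for k
    have "(\<Sum>k\<in>K. c' k * a k j) = (\<Sum>k\<in>K'. c k * (a k0 i * a k j - a k i * a k0 j))" for j
    proof -
      have "(\<Sum>k\<in>K'. c' k * a k j) = (\<Sum>k\<in>K'. c k * a k0 i * a k j)"
        by (rule sum.cong) (use K in \<open>auto simp: c'_def\<close>)
      moreover have "(\<Sum>k\<in>K. c' k * a k j) = (\<Sum>k\<in>K'. c' k * a k j) + c' k0 * a k0 j"
        using K by simp
      ultimately have "(\<Sum>k\<in>K. c' k * a k j)
          = (\<Sum>k\<in>K'. c k * a k0 i * a k j) - (\<Sum>k\<in>K'. c k * a k i) * a k0 j"
        using K by (simp add: c'_def)
      then show ?thesis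
        by (simp add: sum_distrib_right sum_distrib_left sum_subtractf algebra_simps)
    qed
    moreover have "\<exists>k\<in>K. c' k \<noteq> 0" using c(1) k0(2) K by (auto simp: c'_def)
    ultimately show ?thesis using c(2) by (intro exI[of _ c']) (auto simp: algebra_simps)
  qed
qed

abbreviation poly_scale :: "'c::comm_ring_1 poly \<Rightarrow> 'c fps \<Rightarrow> 'c fps" where
  "poly_scale p f \<equiv> fps_of_poly p * f"

interpretation fps_module: module "poly_scale :: 'c::comm_ring_1 poly \<Rightarrow> _"
  by standard (simp_all add: fps_of_poly_add fps_of_poly_mult algebra_simps)

abbreviation monomial :: "('n \<Rightarrow> 'r::comm_monoid_mult) \<Rightarrow> 'n multiset \<Rightarrow> 'r" where
  "monomial U M \<equiv> prod_mset (image_mset U M)"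

text \<open>One replaces \<open>\<tau> U\<^sub>A\<^sup>D\<close> inside a monomial by a combination of products of fewer than \<open>D\<close> factors.
  The total degree drops each time, so at most as many factors \<open>\<tau>\<close> as the degree are
  consumed before all exponents are less than \<open>D\<close>.\<close>

lemma monomial_in_reduced_span:
  fixes U :: "'n \<Rightarrow> 'c::idom fps"
  assumes N: "finite N"
    and red: "\<And>A. A \<in> N \<Longrightarrow> fps_of_poly \<tau> * U A ^ D \<in>
        fps_module.span (monomial U ` {M. set_mset M \<subseteq> N \<and> size M < D})"
    and D: "D > 0" and M: "set_mset M \<subseteq> N"
  shows "fps_of_poly \<tau> ^ size M * monomial U M \<in>
      fps_module.span ((\<lambda>e. \<Prod>A\<in>N. U A ^ e A) ` (N \<rightarrow>\<^sub>E {..<D}))" (is "_ \<in> ?S")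
  using M
proof (induction "size M" arbitrary: M rule: less_induct)
  case less
  show ?case
  proof (cases "\<forall>A\<in>N. count M A < D")
    case True
    have "monomial U M = (\<Prod>A\<in>set_mset M. U A ^ count M A)"
      by (rule image_prod_mset_multiplicity)
    also have "\<dots> = (\<Prod>A\<in>N. U A ^ count M A)"
      by (rule prod.mono_neutral_left) (use N less.prems in \<open>auto simp: not_in_iff\<close>)
    also have "\<dots> = (\<Prod>A\<in>N. U A ^ (restrict (count M) N) A)"
      by (rule prod.cong) auto
    finally have "monomial U M \<in> (\<lambda>e. \<Prod>A\<in>N. U A ^ e A) ` (N \<rightarrow>\<^sub>E {..<D})"
      using True by (intro image_eqI[of _ _ "restrict (count M) N"]) auto
    then show ?thesis
      using fps_module.span_scale[OF fps_module.span_base, of _ _ "\<tau> ^ size M"]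
      by (simp add: fps_of_poly_power)
  next
    case False
    then obtain A where A: "A \<in> N" "D \<le> count M A" by (auto simp: not_less)
    define M' where "M' = M - replicate_mset D A"
    have MM': "M = replicate_mset D A + M'"
      using A by (simp add: M'_def count_le_replicate_mset_subset_eq)
    have sM: "set_mset M' \<subseteq> N" using less.prems MM' by auto
    have "f \<in> fps_module.span (monomial U ` {M. set_mset M \<subseteq> N \<and> size M < D}) \<Longrightarrow>
        fps_of_poly \<tau> ^ (size M - 1) * (monomial U M' * f) \<in> ?S" for f
    proof (induction rule: fps_module.span_induct_alt)
      case base
      show ?case by (simp add: fps_module.span_zero)
    next
      case (step c m f)
      then obtain K where K: "set_mset K \<subseteq> N" "size K < D" "m = monomial U K" by blast
      have sz: "size (M' + K) \<le> size M - 1" "size (M' + K) < size M" using K MM' by auto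
      have "fps_of_poly \<tau> ^ size (M' + K) * monomial U (M' + K) \<in> ?S"
        using less.hyps[of "M' + K"] sz sM K by auto
      then have "fps_of_poly (c * \<tau> ^ (size M - 1 - size (M' + K))) *
          (fps_of_poly \<tau> ^ size (M' + K) * monomial U (M' + K)) \<in> ?S"
        by (rule fps_module.span_scale)
      also have "fps_of_poly (c * \<tau> ^ (size M - 1 - size (M' + K))) *
          (fps_of_poly \<tau> ^ size (M' + K) * monomial U (M' + K))
          = (fps_of_poly \<tau> ^ (size M - 1 - size (M' + K)) * fps_of_poly \<tau> ^ size (M' + K)) *
            (monomial U M' * (fps_of_poly c * m))"
        by (simp only: K(3) fps_of_poly_mult fps_of_poly_power image_mset_union prod_mset_Un mult_ac)
      also have "fps_of_poly \<tau> ^ (size M - 1 - size (M' + K)) * fps_of_poly \<tau> ^ size (M' + K)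
          = fps_of_poly \<tau> ^ (size M - 1)"
        using sz(1) by (metis le_add_diff_inverse2 power_add)
      finally have "fps_of_poly \<tau> ^ (size M - 1) * (monomial U M' * (fps_of_poly c * m)) \<in> ?S" .
      with step show ?case by (simp add: distrib_left fps_module.span_add)
    qed
    from this[OF red[OF A(1)]] have "fps_of_poly \<tau> ^ (size M - 1) *
        (monomial U M' * (fps_of_poly \<tau> * U A ^ D)) \<in> ?S" .
    also have "fps_of_poly \<tau> ^ (size M - 1) * (monomial U M' * (fps_of_poly \<tau> * U A ^ D))
        = (fps_of_poly \<tau> ^ (size M - 1) * fps_of_poly \<tau>) * (U A ^ D * monomial U M')"
      by (simp only: mult_ac)
    also have "fps_of_poly \<tau> ^ (size M - 1) * fps_of_poly \<tau> = fps_of_poly \<tau> ^ size M"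
      using D MM' by (cases "size M") auto
    also have "U A ^ D * monomial U M' = monomial U M"
      by (simp add: MM')
    finally show ?thesis .
  qed
qed

text \<open>Up to factors \<open>\<tau>\<close>, all powers of \<open>U\<^sub>A\<close> lie in a module that is spanned by a finite set, so
  they are linearly dependent. This is the elimination step: it produces an equation in the single
  unknown \<open>U\<^sub>A\<close>.\<close>

lemma algebraic_if_reducible:
  fixes U :: "'n \<Rightarrow> 'c::idom fps"
  assumes N: "finite N" and "\<tau> \<noteq> 0" and "A \<in> N" and D: "D > 0"
    and red: "\<And>A. A \<in> N \<Longrightarrow> fps_of_poly \<tau> * U A ^ D \<in>
        fps_module.span (monomial U ` {M. set_mset M \<subseteq> N \<and> size M < D})"
  shows "algebraic_fps (U A)"
proof -
  define Bas where "Bas = (\<lambda>e. \<Prod>A\<in>N. U A ^ e A) ` (N \<rightarrow>\<^sub>E {..<D})"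
  have fin: "finite Bas" using N by (simp add: Bas_def finite_PiE)
  have "\<exists>a. fps_of_poly \<tau> ^ k * U A ^ k = (\<Sum>b\<in>Bas. fps_of_poly (a b) * b)" for k
  proof -
    have "set_mset (replicate_mset k A) \<subseteq> N" using \<open>A \<in> N\<close> by auto
    from monomial_in_reduced_span[OF N red D this] show ?thesis
      using fps_module.span_finite[OF fin] by (auto simp flip: Bas_def)
  qed
  then obtain a where a: "\<And>k. fps_of_poly \<tau> ^ k * U A ^ k = (\<Sum>b\<in>Bas. fps_of_poly (a k b) * b)"
    by metis
  obtain c where c: "\<exists>k\<in>{..card Bas}. c k \<noteq> 0" "\<forall>b\<in>Bas. (\<Sum>k\<le>card Bas. c k * a k b) = 0"
    using fraction_free_kernel[OF fin, of "{..card Bas}" a] by auto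
  define Q where "Q = (\<Sum>k\<le>card Bas. monom (c k * \<tau> ^ k) k)"
  have coeffQ: "coeff Q k = (if k \<le> card Bas then c k * \<tau> ^ k else 0)" for k
    unfolding Q_def by (simp add: coeff_sum coeff_monom)
  have "Q \<noteq> 0"
    using c(1) \<open>\<tau> \<noteq> 0\<close> coeffQ by (metis atMost_iff coeff_0 mult_eq_0_iff power_not_zero)
  moreover have "eval_fps Q (U A) = 0"
  proof -
    have "degree Q \<le> card Bas" by (rule degree_le) (simp add: coeffQ)
    then have "eval_fps Q (U A) = (\<Sum>k\<le>card Bas. fps_of_poly (coeff Q k) * U A ^ k)"
      unfolding eval_fps_altdef by (intro sum.mono_neutral_left) (auto simp: coeff_eq_0)
    also have "\<dots> = (\<Sum>k\<le>card Bas. fps_of_poly (c k) * (fps_of_poly \<tau> ^ k * U A ^ k))"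
      by (rule sum.cong) (auto simp: coeffQ fps_of_poly_mult fps_of_poly_power)
    also have "\<dots> = (\<Sum>b\<in>Bas. fps_of_poly (\<Sum>k\<le>card Bas. c k * a k b) * b)"
      by (simp add: a sum_distrib_left sum_distrib_right fps_of_poly_sum fps_of_poly_mult mult_ac)
        (rule sum.swap)
    also have "\<dots> = 0" using c(2) by simp
    finally show ?thesis .
  qed
  ultimately show ?thesis by (auto simp: algebraic_fps_def)
qed

section \<open>Specialisation of variables in algebraic relations\<close>

text \<open>Here \<open>\<phi>\<close> is a specialisation whose kernel is generated by \<open>\<pi>\<close>. It could kill all
  coefficients of a relation, but then \<open>\<pi>\<close> can be cancelled, and this ends because no nonzero
  coefficient is divisible by all powers of \<open>\<pi>\<close>.\<close>

lemma primitive_relation: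
  fixes f :: "'c::idom fps" and \<phi> :: "'c poly \<Rightarrow> 'd::zero"
  assumes "Q \<noteq> 0" "eval_fps Q f = 0"
    and \<pi>: "\<And>c. \<phi> c = 0 \<Longrightarrow> \<pi> dvd c" "\<And>c. c \<noteq> 0 \<Longrightarrow> \<exists>n. \<not> \<pi> ^ n dvd c" "\<pi> \<noteq> 0"
    and \<phi>0: "\<phi> 0 = 0"
  shows "\<exists>Q. map_poly \<phi> Q \<noteq> 0 \<and> eval_fps Q f = 0"
proof -
  obtain i where "coeff Q i \<noteq> 0" using assms(1) by (auto simp: poly_eq_iff)
  then obtain n where "\<not> \<pi> ^ n dvd coeff Q i" using \<pi>(2) by blast
  then show ?thesis using assms(2)
  proof (induction n arbitrary: Q)
    case (Suc n)
    show ?case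
    proof (cases "map_poly \<phi> Q = 0")
      case True
      then have "\<phi> (coeff Q j) = 0" for j
        using \<phi>0 by (metis coeff_0 coeff_map_poly)
      then have "[:\<pi>:] dvd Q" using \<pi>(1) by (simp add: const_poly_dvd_iff)
      then obtain Q' where Q': "Q = smult \<pi> Q'" by (auto elim: dvdE)
      then have "fps_of_poly \<pi> * eval_fps Q' f = 0" using Suc.prems by (simp add: eval_fps_smult)
      moreover have "fps_of_poly \<pi> \<noteq> 0" using \<pi>(3) fps_of_poly_eq_iff[of \<pi> 0] by simp
      ultimately have "eval_fps Q' f = 0" by simp
      moreover have "\<not> \<pi> ^ n dvd coeff Q' i"
        using Suc.prems(1) by (simp add: Q' mult_dvd_mono)
      ultimately show ?thesis by (rule Suc.IH[rotated])
    qed (use Suc in blast)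
  qed simp
qed

definition coeff_eval :: "'b::comm_ring_1 \<Rightarrow> 'b poly fps \<Rightarrow> 'b fps" where
  "coeff_eval a f = Abs_fps (\<lambda>n. poly (fps_nth f n) a)"

lemma coeff_eval_0 [simp]: "coeff_eval a 0 = 0"
  by (simp add: coeff_eval_def fps_eq_iff)

lemma coeff_eval_add: "coeff_eval a (f + g) = coeff_eval a f + coeff_eval a g"
  by (simp add: coeff_eval_def fps_eq_iff)

lemma coeff_eval_mult: "coeff_eval a (f * g) = coeff_eval a f * coeff_eval a g"
  by (simp add: coeff_eval_def fps_eq_iff fps_mult_nth poly_sum)

lemma coeff_eval_fps_of_poly: "coeff_eval a (fps_of_poly q) = fps_of_poly (map_poly (\<lambda>c. poly c a) q)"
  by (simp add: coeff_eval_def fps_eq_iff coeff_map_poly)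

lemma coeff_eval_eval_fps:
  "coeff_eval a (eval_fps Q f) = eval_fps (map_poly (map_poly (\<lambda>c. poly c a)) Q) (coeff_eval a f)"
  by (induction Q) (simp_all add: map_poly_pCons coeff_eval_add coeff_eval_mult coeff_eval_fps_of_poly)

lemma not_power_dvd_poly:
  fixes p :: "'b::idom poly"
  assumes "p \<noteq> 0"
  shows "\<not> [:- a, 1:] ^ Suc (order a p) dvd p"
  using assms by (simp add: order_divides del: power_Suc)

lemma algebraic_coeff_eval:
  fixes f :: "'b::idom poly fps"
  assumes "algebraic_fps f"
  shows "algebraic_fps (coeff_eval a f)"
proof -
  let ?\<phi> = "map_poly (\<lambda>c. poly c a)" and ?\<pi> = "[:[:- a, 1:]:]"
  obtain Q where Q: "Q \<noteq> 0" "eval_fps Q f = 0" using assms by (auto simp: algebraic_fps_def)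
  have "\<exists>Q. map_poly ?\<phi> Q \<noteq> 0 \<and> eval_fps Q f = 0"
  proof (rule primitive_relation[OF Q, where \<pi> = ?\<pi>])
    fix c :: "'b poly poly"
    assume "?\<phi> c = 0"
    then have "poly (coeff c i) a = 0" for i
      by (metis (no_types, lifting) coeff_0 coeff_map_poly poly_0)
    then show "?\<pi> dvd c" by (simp add: const_poly_dvd_iff poly_eq_0_iff_dvd)
  next
    fix c :: "'b poly poly"
    assume "c \<noteq> 0"
    then obtain i where "coeff c i \<noteq> 0" by (auto simp: poly_eq_iff)
    then have "\<not> ?\<pi> ^ Suc (order a (coeff c i)) dvd c"
      using not_power_dvd_poly by (auto simp: poly_const_pow const_poly_dvd_iff simp del: power_Suc)
    then show "\<exists>n. \<not> ?\<pi> ^ n dvd c" by blast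
  qed simp_all
  then obtain Q where "map_poly ?\<phi> Q \<noteq> 0" "eval_fps Q f = 0" by blast
  then show ?thesis using coeff_eval_eval_fps[of a Q f] by (auto simp: algebraic_fps_def)
qed

text \<open>A variable that marks the coefficients of a power series cannot be specialised to 1. If each
  power of the other variable occurs with finitely many powers of the marking variable, one
  may exchange the roles of the two variables and evaluate the polynomial coefficients instead. The
  relation says that \<open>f\<close> and \<open>g\<close> are the same double series.\<close>

definition transposed :: "'b::comm_ring_1 poly fps \<Rightarrow> 'b poly fps \<Rightarrow> bool" where
  "transposed f g \<longleftrightarrow> (\<forall>m n. coeff (fps_nth f m) n = coeff (fps_nth g n) m)"

lemma transposed_0: "transposed 0 g \<longleftrightarrow> g = 0"
  by (auto simp: transposed_def fps_eq_iff poly_eq_iff)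

lemma transposed_add: "transposed f g \<Longrightarrow> transposed f' g' \<Longrightarrow> transposed (f + f') (g + g')"
  by (simp add: transposed_def)

lemma transposed_mult:
  assumes "transposed f g" "transposed f' g'"
  shows "transposed (f * f') (g * g')"
  unfolding transposed_def
proof (intro allI)
  fix m n
  have "coeff (fps_nth (f * f') m) n
      = (\<Sum>i=0..m. \<Sum>j\<le>n. coeff (fps_nth f i) j * coeff (fps_nth f' (m - i)) (n - j))"
    by (simp add: fps_mult_nth coeff_sum coeff_mult)
  also have "\<dots> = (\<Sum>j\<le>n. \<Sum>i=0..m. coeff (fps_nth g j) i * coeff (fps_nth g' (n - j)) (m - i))"
    using assms by (subst sum.swap) (simp add: transposed_def)
  also have "\<dots> = coeff (fps_nth (g * g') n) m"
    by (simp add: fps_mult_nth coeff_sum coeff_mult atLeast0AtMost)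
  finally show "coeff (fps_nth (f * f') m) n = coeff (fps_nth (g * g') n) m" .
qed

lemma transposed_fps_of_poly:
  "\<exists>g. transposed (fps_of_poly q) g \<and> coeff_eval a g = fps_of_poly (poly q [:a:])"
proof -
  let ?g = "Abs_fps (\<lambda>n. map_poly (\<lambda>c. coeff c n) q)"
  have "poly (map_poly (\<lambda>c. coeff c n) q) a = coeff (poly q [:a:]) n" for n
    by (induction q) (simp_all add: map_poly_pCons)
  then have "transposed (fps_of_poly q) ?g \<and> coeff_eval a ?g = fps_of_poly (poly q [:a:])"
    by (simp add: transposed_def coeff_eval_def fps_eq_iff coeff_map_poly)
  then show ?thesis by blast
qed

lemma transposed_eval_fps:
  assumes "transposed f g"
  shows "\<exists>h. transposed (eval_fps Q f) h \<and>
      coeff_eval a h = eval_fps (map_poly (\<lambda>q. poly q [:a:]) Q) (coeff_eval a g)"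
proof (induction Q)
  case 0
  show ?case by (intro exI[of _ 0]) (simp add: transposed_0)
next
  case (pCons q Q)
  obtain h where h: "transposed (eval_fps Q f) h"
      "coeff_eval a h = eval_fps (map_poly (\<lambda>q. poly q [:a:]) Q) (coeff_eval a g)"
    using pCons.IH by blast
  obtain k where k: "transposed (fps_of_poly q) k" "coeff_eval a k = fps_of_poly (poly q [:a:])"
    using transposed_fps_of_poly by blast
  have "transposed (eval_fps (pCons q Q) f) (k + g * h)"
    using transposed_add[OF k(1) transposed_mult[OF assms h(1)]] by simp
  moreover have "coeff_eval a (k + g * h)
      = eval_fps (map_poly (\<lambda>q. poly q [:a:]) (pCons q Q)) (coeff_eval a g)"
    by (simp add: coeff_eval_add coeff_eval_mult h k map_poly_pCons)
  ultimately show ?case by blast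
qed

lemma algebraic_coeff_eval_transposed:
  fixes f :: "'b::idom poly fps"
  assumes "algebraic_fps f" and "transposed f g"
  shows "algebraic_fps (coeff_eval a g)"
proof -
  let ?\<phi> = "\<lambda>q. poly q [:a:]" and ?\<pi> = "[:- [:a:], 1:]"
  obtain Q where Q: "Q \<noteq> 0" "eval_fps Q f = 0" using assms by (auto simp: algebraic_fps_def)
  have "\<exists>Q. map_poly ?\<phi> Q \<noteq> 0 \<and> eval_fps Q f = 0"
  proof (rule primitive_relation[OF Q, where \<pi> = ?\<pi>])
    show "\<exists>n. \<not> ?\<pi> ^ n dvd c" if "c \<noteq> 0" for c
      using not_power_dvd_poly[OF that] by blast
  qed (simp_all add: poly_eq_0_iff_dvd)
  then obtain Q where Q: "map_poly ?\<phi> Q \<noteq> 0" "eval_fps Q f = 0" by blast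
  then obtain h where "transposed 0 h" "coeff_eval a h = eval_fps (map_poly ?\<phi> Q) (coeff_eval a g)"
    using transposed_eval_fps[OF assms(2), of Q a] by auto
  then have "eval_fps (map_poly ?\<phi> Q) (coeff_eval a g) = 0" by (simp add: transposed_0)
  then show ?thesis using Q by (auto simp: algebraic_fps_def)
qed

section \<open>Counting words of unambiguous grammars\<close>

text \<open>The deformation of the grammar. For \<open>D\<close> greater than the lengths of all right-hand sides, the
  new productions are recognised by their length \<open>D\<close>.\<close>

definition pad_rules :: "nat \<Rightarrow> ('n, 'a) cfg \<Rightarrow> ('n, 'a) cfg" where
  "pad_rules D G = G\<lparr>productions :=
     productions G \<union> (\<lambda>A. (A, replicate D (Nt A))) ` nonterminals G\<rparr>"

lemma wf_pad_rules: "wf_cfg G \<Longrightarrow> wf_cfg (pad_rules D G)"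
  using finite_nonterminals[of G] by (simp add: wf_cfg_def pad_rules_def)

lemma coeff_eval_tree_gf:
  "coeff_eval a (tree_gf G \<omega> x s) = tree_gf G (\<lambda>p. poly (\<omega> p) a) (poly x a) s"
proof -
  have "poly (prod_list ps) a = prod_list (map (\<lambda>p. poly p a) ps)" for ps
    by (induction ps) simp_all
  then have "poly (tree_weight \<omega> x t) a = tree_weight (\<lambda>p. poly (\<omega> p) a) (poly x a) t" for t
    by (induction t) (simp_all add: comp_def cong: map_cong)
  then show ?thesis by (simp add: coeff_eval_def tree_gf_def graded_gf_def fps_eq_iff poly_sum)
qed

lemma prod_list_monom: "prod_list (map (\<lambda>t. monom (1::'b::comm_ring_1) (f t)) ts) = monom 1 (sum_list (map f ts))"
  by (induction ts) (simp_all add: mult_monom)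

text \<open>Giving the new productions the weight 0 undoes the deformation.\<close>

lemma tree_weight_pad_rules:
  fixes G :: "('n, 'a) cfg"
  assumes D: "\<And>A \<alpha>. (A, \<alpha>) \<in> productions G \<Longrightarrow> length \<alpha> < D"
    and "conforms (pad_rules D G) t"
  shows "tree_weight (\<lambda>(A, \<alpha>). if length \<alpha> = D then 0 else 1) (monom 1 1) t =
    (if conforms G t then monom (1::'b::comm_ring_1) (length (frontier t)) else 0)" (is "?w t = _")
  using assms(2)
proof (induction t)
  case (Leaf a)
  then show ?case by simp
next
  case (Node A ts)
  show ?case
  proof (cases "length ts = D")
    case True
    then have "(A, map root_symbol ts) \<notin> productions G" using D by fastforce
    then show ?thesis using True by simp
  next
    case False
    then have P: "(A, map root_symbol ts) \<in> productions G"
      using Node.prems by (auto simp: pad_rules_def dest: arg_cong[of _ _ length])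
    have IH: "?w t = (if conforms G t then monom 1 (length (frontier t)) else 0)" if "t \<in> set ts" for t
      using Node that by auto
    show ?thesis
    proof (cases "\<forall>t\<in>set ts. conforms G t")
      case True
      then have "map ?w ts = map (\<lambda>t. monom 1 (length (frontier t))) ts" using IH by auto
      then have "prod_list (map ?w ts) = monom 1 (sum_list (map (\<lambda>t. length (frontier t)) ts))"
        by (simp only: prod_list_monom)
      then show ?thesis using P False True by (simp add: length_concat comp_def)
    next
      case nt: False
      then have "0 \<in> set (map ?w ts)" using IH by force
      then have "prod_list (map ?w ts) = 0" by (induction ts) auto
      then show ?thesis using P False nt by auto
    qed
  qed
qed

lemma form_gf_is_scaled_monomial:
  assumes "set \<alpha> \<subseteq> Nt ` N \<union> range Tm"
  shows "\<exists>c M. set_mset M \<subseteq> N \<and> size M \<le> length \<alpha> \<and>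
      prod_list (map (tree_gf G \<omega> x) \<alpha>) = fps_of_poly c * monomial (\<lambda>A. tree_gf G \<omega> x (Nt A)) M"
  using assms
proof (induction \<alpha>)
  case Nil
  show ?case by (intro exI[of _ 1] exI[of _ "{#}"]) simp
next
  case (Cons s \<alpha>)
  then obtain c M where cM: "set_mset M \<subseteq> N" "size M \<le> length \<alpha>"
      "prod_list (map (tree_gf G \<omega> x) \<alpha>) = fps_of_poly c * monomial (\<lambda>A. tree_gf G \<omega> x (Nt A)) M"
    by auto
  show ?case
  proof (cases s)
    case (Tm a)
    then show ?thesis using cM
      by (intro exI[of _ "[:x:] * c"] exI[of _ M])
        (simp add: tree_gf_Tm fps_of_poly_smult mult.assoc)
  next
    case (Nt A)
    then show ?thesis using cM Cons.prems
      by (intro exI[of _ c] exI[of _ "add_mset A M"]) (auto simp: mult_ac)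
  qed
qed

text \<open>The deformed system expresses \<open>t \<sigma> U\<^sub>A\<^sup>D\<close> by monomials of lower degree, where \<open>t\<close> is
  \<^term>\<open>fps_X\<close> and \<open>t \<sigma>\<close> is the polynomial \<open>[:0, \<sigma>:]\<close>.\<close>

lemma algebraic_tree_gf_pad_rules:
  fixes G :: "('n, 'a) cfg" and \<sigma> x :: "'b::idom"
  assumes G: "wf_cfg G" and D: "\<And>A \<alpha>. (A, \<alpha>) \<in> productions G \<Longrightarrow> length \<alpha> < D" "1 < D"
    and \<sigma>: "\<sigma> \<noteq> 0" and A: "A \<in> nonterminals G"
  shows "algebraic_fps (tree_gf (pad_rules D G) (\<lambda>(A, \<alpha>). if length \<alpha> = D then \<sigma> else 1) x (Nt A))"
proof -
  let ?\<omega> = "\<lambda>(A :: 'n, \<alpha> :: ('n, 'a) symbol list). if length \<alpha> = D then \<sigma> else 1"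
  let ?N = "nonterminals G"
  define U where "U A = tree_gf (pad_rules D G) ?\<omega> x (Nt A)" for A
  let ?S = "fps_module.span (monomial U ` {M. set_mset M \<subseteq> ?N \<and> size M < D})"
  have "fps_of_poly [:0, \<sigma>:] * U B ^ D \<in> ?S" if B: "B \<in> ?N" for B
  proof -
    let ?R = "{\<alpha>. (B, \<alpha>) \<in> productions G}" and ?gf = "tree_gf (pad_rules D G) ?\<omega> x"
    have R: "{\<alpha>. (B, \<alpha>) \<in> productions (pad_rules D G)} = insert (replicate D (Nt B)) ?R"
      using B by (auto simp: pad_rules_def)
    have notin: "(B, replicate D (Nt B)) \<notin> productions G" using D(1)[of B "replicate D (Nt B)"] by auto
    have "U B = fps_X * (fps_const \<sigma> * U B ^ D + (\<Sum>\<alpha>\<in>?R. fps_const (?\<omega> (B, \<alpha>)) * prod_list (map ?gf \<alpha>)))"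
      unfolding U_def by (subst tree_gf_Nt[OF wf_pad_rules[OF G]], subst R)
        (simp add: notin finite_rules[OF G])
    also have "(\<Sum>\<alpha>\<in>?R. fps_const (?\<omega> (B, \<alpha>)) * prod_list (map ?gf \<alpha>)) = (\<Sum>\<alpha>\<in>?R. prod_list (map ?gf \<alpha>))"
      using D(1) by (intro sum.cong) auto
    finally have UB: "U B = fps_X * (fps_const \<sigma> * U B ^ D + (\<Sum>\<alpha>\<in>?R. prod_list (map ?gf \<alpha>)))" .
    have \<tau>: "fps_of_poly [:0, \<sigma>:] = fps_X * fps_const \<sigma>"
      by (simp add: fps_of_poly_pCons mult.commute)
    have "fps_of_poly [:0, \<sigma>:] * U B ^ D + (\<Sum>\<alpha>\<in>?R. fps_X * prod_list (map ?gf \<alpha>))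
        = fps_X * (fps_const \<sigma> * U B ^ D + (\<Sum>\<alpha>\<in>?R. prod_list (map ?gf \<alpha>)))"
      unfolding \<tau> distrib_left sum_distrib_left mult.assoc by (rule refl)
    also have "\<dots> = U B" by (rule UB[symmetric])
    finally have eq: "fps_of_poly [:0, \<sigma>:] * U B ^ D = U B - (\<Sum>\<alpha>\<in>?R. fps_X * prod_list (map ?gf \<alpha>))"
      by (rule iffD2[OF eq_diff_eq])
    have "U B \<in> ?S"
      using B D(2) by (intro fps_module.span_base image_eqI[of _ _ "{#B#}"]) auto
    moreover have "fps_X * prod_list (map ?gf \<alpha>) \<in> ?S" if "\<alpha> \<in> ?R" for \<alpha>
    proof -
      have "(B, \<alpha>) \<in> productions G" using that by (rule CollectD)
      then have "set \<alpha> \<subseteq> Nt ` ?N \<union> range Tm"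
        by (intro subsetI) (rule productions_nonterminals)
      from form_gf_is_scaled_monomial[OF this, of "pad_rules D G" ?\<omega> x]
      obtain c M where M: "set_mset M \<subseteq> ?N" "size M \<le> length \<alpha>"
          "prod_list (map ?gf \<alpha>) = fps_of_poly c * monomial U M"
        unfolding U_def by blast
      then have "monomial U M \<in> ?S"
        using D(1)[of B \<alpha>] that by (intro fps_module.span_base imageI) auto
      then have "fps_of_poly ([:0, 1:] * c) * monomial U M \<in> ?S" by (rule fps_module.span_scale)
      then show ?thesis
        by (simp only: M(3) fps_of_poly_mult fps_of_poly_fps_X mult.assoc)
    qed
    ultimately show ?thesis
      unfolding eq by (intro fps_module.span_diff fps_module.span_sum) auto
  qed
  then have "algebraic_fps (U A)"
    using algebraic_if_reducible[of ?N "[:0, \<sigma>:]" A D U] finite_nonterminals[OF G] \<sigma> A D(2) by simp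
  then show ?thesis by (simp add: U_def)
qed

text \<open>The specialisations are made in this order: \<open>\<sigma> = 0\<close> leaves the trees of the given grammar,
  in which every word has exactly one tree, so that each length has finitely many trees and the
  node-counting variable can be set to 1. For \<open>\<sigma> \<noteq> 0\<close> this would be impossible, because the new
  productions give infinitely many trees for each word as soon as the empty word is one of them.\<close>

theorem chomsky_schuetzenberger:
  fixes G :: "('n, 'a) cfg"
  assumes G: "wf_cfg G" and unamb: "unambiguous G"
    and fin: "\<And>n. finite {w \<in> language G. length w = n}"
  shows "algebraic_fps (Abs_fps (\<lambda>n. rat_of_nat (card {w \<in> language G. length w = n})))"
proof -
  \<comment> \<open>At least 2, so that a single nonterminal is a monomial of degree less than \<open>D\<close>.\<close>
  define D where "D = Max (insert 0 ((\<lambda>(A, \<alpha>). length \<alpha>) ` productions G)) + 2"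
  have D: "length \<alpha> < D" if "(A, \<alpha>) \<in> productions G" for A \<alpha>
  proof -
    have "length \<alpha> \<le> Max (insert 0 ((\<lambda>(A, \<alpha>). length \<alpha>) ` productions G))"
      using G that by (intro Max_ge) (force simp: wf_cfg_def)+
    then show ?thesis by (simp add: D_def)
  qed
  have D1: "1 < D" by (simp add: D_def)
  let ?H = "pad_rules D G"
  define V where "V = tree_gf ?H (\<lambda>(A, \<alpha>). if length \<alpha> = D then 0 else 1) (monom (1 :: rat) 1) (Nt (start G))"
  have algU: "algebraic_fps (tree_gf ?H (\<lambda>(A, \<alpha>). if length \<alpha> = D then [:0, 1:] else 1)
      [:monom (1 :: rat) 1:] (Nt (start G)))"
    by (rule algebraic_tree_gf_pad_rules[OF G D D1]) (auto simp: nonterminals_def)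
  have algV: "algebraic_fps V"
  proof -
    have "(\<lambda>p. poly (case p of (A :: 'n, \<alpha> :: ('n, 'a) symbol list) \<Rightarrow> if length \<alpha> = D then [:0, 1 :: rat poly:] else 1) 0)
        = (\<lambda>(A, \<alpha>). if length \<alpha> = D then 0 else 1)"
      by auto
    then show ?thesis
      using algebraic_coeff_eval[OF algU, of 0] by (simp add: coeff_eval_tree_gf V_def)
  qed
  \<comment> \<open>By unambiguity, trees with \<open>n\<close> leaves correspond to words of length \<open>n\<close>, so their number is finite.\<close>
  define T where "T n = {t. conforms G t \<and> root_symbol t = Nt (start G) \<and> length (frontier t) = n}" for n
  have bij: "bij_betw frontier (T n) {w \<in> language G. length w = n}" for n
  proof (rule bij_betw_imageI)
    show "inj_on frontier (T n)"
    proof (rule inj_onI)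
      fix t t' assume "t \<in> T n" "t' \<in> T n" "frontier t = frontier t'"
      then have "derivation_tree G t (frontier t)" "derivation_tree G t' (frontier t)"
        by (auto simp: T_def derivation_tree_def)
      then show "t = t'"
        using unamb unfolding unambiguous_def language_eq_trees by blast
    qed
    show "frontier ` T n = {w \<in> language G. length w = n}"
      by (auto simp: T_def language_eq_trees derivation_tree_def)
  qed
  have finT: "finite (T n)" for n
    using bij_betw_finite[OF bij] fin by blast
  define W where "W = Abs_fps (\<lambda>n. \<Sum>t\<in>T n. monom (1 :: rat) (node_count t))"
  have "transposed V W"
    unfolding transposed_def
  proof (intro allI)
    fix m n
    let ?X = "{t \<in> trees ?H (Nt (start G)). node_count t = m}"
    have GH: "conforms ?H t" if "conforms G t" for t
      using that by (induction t) (auto simp: pad_rules_def)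
    have "coeff (fps_nth V m) n =
        (\<Sum>t\<in>?X. coeff (tree_weight (\<lambda>(A, \<alpha>). if length \<alpha> = D then 0 else 1) (monom (1 :: rat) 1) t) n)"
      by (simp add: V_def tree_gf_def graded_gf_def coeff_sum)
    also have "\<dots> = (\<Sum>t\<in>?X. if t \<in> T n then 1 else 0)"
    proof (rule sum.cong[OF refl])
      fix t assume t: "t \<in> ?X"
      then have "conforms ?H t" by (simp add: trees_def)
      with t show "coeff (tree_weight (\<lambda>(A, \<alpha>). if length \<alpha> = D then 0 else 1) (monom (1 :: rat) 1) t) n
          = (if t \<in> T n then 1 else 0)"
        using D by (subst tree_weight_pad_rules[where G = G]) (auto simp: trees_def T_def coeff_monom)
    qed
    also have "\<dots> = of_nat (card {t \<in> T n. node_count t = m})"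
    proof -
      have "{t \<in> T n. node_count t = m} = ?X \<inter> T n"
        using GH by (auto simp: trees_def T_def)
      then show ?thesis
        using finite_trees[OF wf_pad_rules[OF G], of D "Nt (start G)" m] by (simp add: sum.If_cases)
    qed
    also have "\<dots> = coeff (fps_nth W n) m"
      using finT[of n] by (simp add: W_def coeff_sum coeff_monom sum.If_cases Int_def)
    finally show "coeff (fps_nth V m) n = coeff (fps_nth W n) m" .
  qed
  from algebraic_coeff_eval_transposed[OF algV this, of 1]
  have "algebraic_fps (coeff_eval 1 W)" .
  moreover have "coeff_eval 1 W = Abs_fps (\<lambda>n. of_nat (card {w \<in> language G. length w = n}))"
    using bij_betw_same_card[OF bij] by (simp add: coeff_eval_def W_def poly_sum poly_monom fps_eq_iff)
  ultimately show ?thesis by simp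
qed

theorem theorem5:
  shows "\<not> unambiguously_context_free {u \<in> lists {0, 1}. \<not> subword u thue_morse}"
proof
  let ?L = "{u \<in> lists {0, 1}. \<not> subword u thue_morse}"
  assume "unambiguously_context_free ?L"
  then obtain G :: "(nat, nat) cfg" where G: "wf_cfg G" "unambiguous G" "language G = ?L"
    unfolding unambiguously_context_free_def by blast
  have "finite {w \<in> language G. length w = n}" for n
    unfolding G(3) by (rule finite_subset[OF _ finite_binary_words[of n]]) auto
  from chomsky_schuetzenberger[OF G(1,2) this] show False
    unfolding G(3) using non_subword_series_not_algebraic by blast
qed

end
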